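(* Let $X=(X_n)_{n\in\mathbb{N}_0}$ be a martingale with values in a separable Hilbert space $(H,\langle\cdot,\cdot\rangle)$ (with norm $\|\cdot\|$), with $X_0=0$, with respect to a filtration $\mathbb{F}=(\mathcal{F}_n)_{n\geq 0}$. Set $\Delta X_j:=X_j-X_{j-1}$ for $j\in\mathbb{N}$. Let $p\geq 2$ and assume that for $$\beta_{n,p}:=\frac1n\,\mathbb{E}\Big[\sum_{j=1}^n\|\Delta X_j\|^p+\Big(\sum_{j=1}^n\mathbb{E}\big[\|\Delta X_j\|^2\,\big|\,\mathcal{F}_{j-1}\big]\Big)^{\frac p2}\Big]$$ we have $$K_p:=\sum_{n=1}^\infty\frac{\beta_{n,p}}{n^{p-1}}<\infty.$$ Then $\lim_{n\to\infty}\frac{X_n}{n}=0$ $\mathbb{P}$-a.s. In addition, we have the following, with $C_p:=2^{\frac{3p}{2}}\big(\frac p4+1\big)\big(1+\frac{p}{\ln(p/2)}\big)^p$: (a) For any $\varepsilon>0$, with $\mathcal{O}_\varepsilon:=\sum_{n=1}^\infty\mathbf{1}\{\|\frac{X_n}{n}\|>\varepsilon\}$, $\mathbf{m}_\varepsilon:=\max\{n\geq1:\|\frac{X_n}{n}\|>\varepsilon\}$, and any positive, nondecreasing sequence $a=(a_n)_{n\in\mathbb{N}}$ such that $$K_{a,p}:=\sum_{n=1}^\infty a_n\sum_{m=n}^\infty\frac{\beta_{m,p}}{m^{p-1}}<\infty,$$ we have $$\mathbb{E}[\mathcal{S}_{a,1}(\mathcal{O}_\varepsilon)]\leq\mathbb{E}[\mathcal{S}_{a,1}(\mathbf{m}_\varepsilon)]<C_p\,K_{a,p}$$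 and $$\mathbb{P}(\mathcal{O}_\varepsilon\geq k)\leq\mathbb{P}(\mathbf{m}_\varepsilon\geq k)\leq\mathcal{S}_{a,1}(k)^{-1}\,C_p\,K_{a,p}\qquad\text{for all }k\geq1.$$ (b) For any positive, nonincreasing sequence $\epsilon=(\varepsilon_n)_{n\in\mathbb{N}}$ and any positive, nondecreasing sequence $a=(a_n)_{n\in\mathbb{N}}$ such that $$K_{a,\epsilon,p}:=\sum_{n=1}^\infty a_n\sum_{m=n}^\infty\frac{\beta_{m,p}}{\varepsilon_m^p\,m^{p-1}}<\infty,$$ we have $$\limsup_{n\to\infty}\Big\|\frac{X_n}{n}\Big\|\cdot\varepsilon_n^{-1}\leq1\qquad\mathbb{P}\text{-a.s.},$$ and the quantities $\mathcal{O}_\epsilon:=\sum_{n=1}^\infty\mathbf{1}\{\|\frac{X_n}{n}\|>\varepsilon_n\}$ and $\mathbf{m}_\epsilon:=\max\{n\geq1:\|\frac{X_n}{n}\|>\varepsilon_n\}$ satisfy $$\mathbb{E}[\mathcal{S}_{a,1}(\mathcal{O}_\epsilon)]\leq\mathbb{E}[\mathcal{S}_{a,1}(\mathbf{m}_\epsilon)]\leq C_p\,K_{a,\epsilon,p}.$$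
   Context: $\mathbb{N}=\{1,2,\dots\}$, $\mathbb{N}_0=\mathbb{N}\cup\{0\}$. $\mathbf{1}$ denotes an indicator function. $\mathcal{S}_{a,1}(N):=\sum_{n=0}^{N-1}a_{1+n}=\sum_{n=1}^{N}a_n$ for $N\in\mathbb{N}$, and $\mathcal{S}_{a,1}(0):=0$.
   Formalization: In (a) the upper bounds use C_p ε^{-p} instead of C_p (the printed bound fails for X_n = ±1 constant in n≥1, p>2, small ε), and the strict inequality is claimed only if K_{a,p} > 0 (for X = 0 it would read 0 < 0), with ≤ in all cases. *)

theory Defs
  imports "HOL-Probability.Probability"
begin

text \<open>
  \<^term>\<open>g\<close> is a version of the (Bochner) conditional expectation of \<^term>\<open>f\<close> given \<^term>\<open>G\<close>.
  Only the sets of \<^term>\<open>G\<close> matter, its own measure is ignored. The library provides conditional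
  expectations of real-valued and nonnegative extended-valued functions only.
\<close>
definition has_cond_exp ::
  "'a measure \<Rightarrow> 'a measure \<Rightarrow> ('a \<Rightarrow> 'h::{banach, second_countable_topology}) \<Rightarrow> ('a \<Rightarrow> 'h) \<Rightarrow> bool"
where
  "has_cond_exp M G f g \<longleftrightarrow>
     integrable M f \<and> integrable M g \<and> g \<in> borel_measurable G \<and>
     (\<forall>A\<in>sets G. set_lebesgue_integral M A f = set_lebesgue_integral M A g)"

definition martingale ::
  "'a measure \<Rightarrow> (nat \<Rightarrow> 'a measure) \<Rightarrow> (nat \<Rightarrow> 'a \<Rightarrow> 'h::{banach, second_countable_topology}) \<Rightarrow> bool"
where
  "martingale M F X \<longleftrightarrow>
     filtration (space M) F \<and> (\<forall>n. subalgebra M (F n)) \<and>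
     (\<forall>n. X n \<in> borel_measurable (F n)) \<and> (\<forall>n. integrable M (X n)) \<and>
     (\<forall>m n. m \<le> n \<longrightarrow> has_cond_exp M (F m) (X n) (X m))"

definition incr :: "(nat \<Rightarrow> 'a \<Rightarrow> 'h::real_normed_vector) \<Rightarrow> nat \<Rightarrow> 'a \<Rightarrow> 'h" where
  "incr X j \<omega> = X j \<omega> - X (j - 1) \<omega>"

text \<open>The power function on \<open>[0, \<infinity>]\<close>, meant for exponents \<open>r > 0\<close>.\<close>
definition epowr :: "ennreal \<Rightarrow> real \<Rightarrow> ennreal" where
  "epowr x r = (if x = \<infinity> then \<infinity> else ennreal (enn2real x powr r))"

text \<open>
  Since a martingale is only assumed integrable, the expectation and the conditional second moments
  below are taken in \<open>[0, \<infinity>]\<close>. Used for \<open>n \<ge> 1\<close>.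
\<close>
definition moment_beta ::
  "'a measure \<Rightarrow> (nat \<Rightarrow> 'a measure) \<Rightarrow> (nat \<Rightarrow> 'a \<Rightarrow> 'h::real_normed_vector) \<Rightarrow> real \<Rightarrow> nat \<Rightarrow> ennreal"
where
  "moment_beta M F X p n =
     (\<integral>\<^sup>+ \<omega>. (\<Sum>j=1..n. ennreal (norm (incr X j \<omega>) powr p)) +
            epowr (\<Sum>j=1..n. nn_cond_exp M (F (j - 1)) (\<lambda>\<omega>'. ennreal ((norm (incr X j \<omega>'))\<^sup>2)) \<omega>) (p / 2)
      \<partial>M) / ennreal (real n)"

text \<open>
  Series over \<open>n \<ge> 1\<close> are written with \<open>Suc n\<close>, and the inner series over \<open>m \<ge> n\<close> below
  with \<open>Suc n + i\<close>.
\<close>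
definition K_moment ::
  "'a measure \<Rightarrow> (nat \<Rightarrow> 'a measure) \<Rightarrow> (nat \<Rightarrow> 'a \<Rightarrow> 'h::real_normed_vector) \<Rightarrow> real \<Rightarrow> ennreal"
where
  "K_moment M F X p = (\<Sum>n. moment_beta M F X p (Suc n) / ennreal (real (Suc n) powr (p - 1)))"

definition K_weighted ::
  "'a measure \<Rightarrow> (nat \<Rightarrow> 'a measure) \<Rightarrow> (nat \<Rightarrow> 'a \<Rightarrow> 'h::real_normed_vector) \<Rightarrow> real \<Rightarrow>
   (nat \<Rightarrow> real) \<Rightarrow> ennreal"
where
  "K_weighted M F X p a =
     (\<Sum>n. ennreal (a (Suc n)) *
       (\<Sum>i. moment_beta M F X p (Suc n + i) / ennreal (real (Suc n + i) powr (p - 1))))"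

definition K_weighted_tol ::
  "'a measure \<Rightarrow> (nat \<Rightarrow> 'a measure) \<Rightarrow> (nat \<Rightarrow> 'a \<Rightarrow> 'h::real_normed_vector) \<Rightarrow> real \<Rightarrow>
   (nat \<Rightarrow> real) \<Rightarrow> (nat \<Rightarrow> real) \<Rightarrow> ennreal"
where
  "K_weighted_tol M F X p a e =
     (\<Sum>n. ennreal (a (Suc n)) *
       (\<Sum>i. moment_beta M F X p (Suc n + i) /
              ennreal (e (Suc n + i) powr p * real (Suc n + i) powr (p - 1))))"

text \<open>
  At \<open>p = 2\<close> the formula divides by \<open>ln 1 = 0\<close>; the value there is immaterial, because the
  numerators \<open>n * \<beta>\<^sub>n\<close> are nondecreasing, so that for \<open>p = 2\<close> finiteness of \<^const>\<open>K_weighted\<close> or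
  \<^const>\<open>K_weighted_tol\<close> (for positive nondecreasing \<open>a\<close> and positive nonincreasing \<open>e\<close>)
  forces these quantities to vanish.
\<close>
definition C_const :: "real \<Rightarrow> real" where
  "C_const p = 2 powr (3 * p / 2) * (p / 4 + 1) * (1 + p / ln (p / 2)) powr p"

text \<open>\<open>S\<^bsub>a,1\<^esub>(N)\<close>, extended to \<open>N = \<infinity>\<close> by the full series.\<close>
definition S_sum :: "(nat \<Rightarrow> real) \<Rightarrow> enat \<Rightarrow> ennreal" where
  "S_sum a N = (case N of enat k \<Rightarrow> \<Sum>n<k. ennreal (a (1 + n)) | \<infinity> \<Rightarrow> \<Sum>n. ennreal (a (1 + n)))"

text \<open>
  The number of exceedances and the last exceedance time of the path \<open>X\<^sub>n(\<omega>) / n\<close>, \<open>n \<ge> 1\<close>, over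
  the tolerances \<open>e\<^sub>n\<close>. Both are \<open>\<infinity>\<close> when there are infinitely many exceedances. For a finite
  nonempty set of exceedance times the supremum is its maximum; for the empty set it is \<open>0\<close>.
\<close>
definition exceed_count :: "(nat \<Rightarrow> 'a \<Rightarrow> 'h::real_normed_vector) \<Rightarrow> (nat \<Rightarrow> real) \<Rightarrow> 'a \<Rightarrow> enat" where
  "exceed_count X e \<omega> =
     (\<Sum>n. if norm (X (Suc n) \<omega> /\<^sub>R real (Suc n)) > e (Suc n) then 1 else 0)"

definition last_exceed :: "(nat \<Rightarrow> 'a \<Rightarrow> 'h::real_normed_vector) \<Rightarrow> (nat \<Rightarrow> real) \<Rightarrow> 'a \<Rightarrow> enat" where
  "last_exceed X e \<omega> = Sup (enat ` {n. 1 \<le> n \<and> norm (X n \<omega> /\<^sub>R real n) > e n})"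

end

theory Submission
  imports Defs
begin

text \<open>
  Since \<open>n * \<beta>\<^sub>n / n powr p = \<beta>\<^sub>n / n powr (p - 1)\<close>, a moment bound
  \<open>E \<parallel>X\<^sub>n\<parallel>\<^sup>p \<le> K * n * \<beta>\<^sub>n\<close> with \<open>K < C_const p\<close> suffices: Markov's inequality and the union bound over
  \<open>m \<ge> n\<close> estimate the probability that the last exceedance is at least \<open>n\<close>, summation against \<open>a\<close>
  gives the moment estimates, and the Borel--Cantelli lemma gives the almost sure statements. No
  maximal inequality is needed, and the slack \<open>K < C_const p\<close> yields the strict inequality.

  The moment bound is a Burkholder--Rosenthal inequality, with \<open>q = p / 2\<close>. It is proved with a
  Bellman function \<open>U(\<parallel>x\<parallel>\<^sup>2, s)\<close>, essentially \<open>(\<parallel>x\<parallel>\<^sup>2 - c * s)\<^sub>+\<^sup>q\<close>, evaluated along \<open>X\<close> and its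
  predictable variance. Jumps with \<open>\<parallel>d\<parallel> > th * \<parallel>x\<parallel>\<close> cost \<open>(1 + 1 / th)\<^sup>p * \<parallel>d\<parallel>\<^sup>p\<close>. The
  second-order Taylor term of the other jumps is absorbed by the decrease of \<open>U\<close> in \<open>s\<close> where \<open>\<parallel>x\<parallel>\<^sup>2\<close> is
  large compared to \<open>s\<close>, and by the increase of \<open>s\<^sup>q\<close> elsewhere. Taking \<open>th\<close> of order \<open>ln p / p\<close>
  produces the factor \<open>(p / ln p)\<^sup>p\<close> of \<open>C_const p\<close>.
\<close>

subsection \<open>Power functions\<close>

text \<open>Convexity of \<open>u powr q\<close>. For positive \<open>u\<close> and \<open>w\<close>
  it is Young's inequality with weights \<open>1 / q\<close> and \<open>1 - 1 / q\<close>, applied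
  to \<open>u powr q\<close> and \<open>w powr q\<close> and multiplied by \<open>q\<close>.\<close>

lemma powr_tangent:
  fixes u w q :: real
  assumes "1 \<le> q" "0 \<le> u" "0 \<le> w"
  shows "w powr q + q * w powr (q - 1) * (u - w) \<le> u powr q"
proof (cases "u = 0 \<or> w = 0")
  case True
  then show ?thesis
  proof (cases "w = 0")
    case False
    then have u: "u = 0" and w: "w > 0" using True assms by auto
    have "w powr (q - 1) * w = w powr q"
      using w by (simp add: powr_diff)
    then have "w powr q + q * w powr (q - 1) * (u - w) = (1 - q) * w powr q"
      using u by (simp add: algebra_simps)
    also have "\<dots> \<le> 0" using assms by (simp add: mult_nonpos_nonneg)
    finally show ?thesis using u by simp
  qed (use assms in auto)
next
  case False
  then have pos: "u > 0" "w > 0" using assms by auto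
  have "(u powr q) powr (1 / q) * (w powr q) powr (1 - 1 / q)
      \<le> 1 / q * u powr q + (1 - 1 / q) * w powr q"
    using assms pos by (intro Youngs_inequality_0) auto
  moreover have "(u powr q) powr (1 / q) = u"
    using assms pos by (simp add: powr_powr)
  moreover have "(w powr q) powr (1 - 1 / q) = w powr (q - 1)"
    using assms by (simp add: powr_powr algebra_simps)
  ultimately have "q * (u * w powr (q - 1)) \<le> q * (1 / q * u powr q + (1 - 1 / q) * w powr q)"
    using assms by (intro mult_left_mono) auto
  also have "\<dots> = u powr q + (q - 1) * w powr q"
    using assms by (simp add: algebra_simps)
  finally have "q * (u * w powr (q - 1)) \<le> u powr q + (q - 1) * w powr q" .
  moreover have "w powr q = w powr (q - 1) * w"
    using pos by (simp add: powr_diff)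
  ultimately show ?thesis by (simp add: algebra_simps)
qed

text \<open>Follows from \<open>s powr q = s powr (q - 1) * s\<close> and monotonicity. It bounds a
  cost proportional to a variance increment by an increment of \<open>s powr q\<close>, which
  telescopes along the path.\<close>

lemma diff_powr_ge:
  fixes q s s' :: real
  assumes "1 \<le> q" "0 \<le> s" "s \<le> s'"
  shows "s' powr (q - 1) * (s' - s) \<le> s' powr q - s powr q"
proof (cases "s = 0")
  case True
  then show ?thesis using assms by (cases "s' = 0") (auto simp: powr_diff)
next
  case False
  then have s: "s > 0" "s' > 0" using assms by auto
  have "s powr (q - 1) * s \<le> s' powr (q - 1) * s"
    using assms s by (intro mult_right_mono powr_mono2) auto
  moreover have "s powr q = s powr (q - 1) * s" "s' powr q = s' powr (q - 1) * s'"
    using s by (auto simp: powr_diff)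
  ultimately show ?thesis by (simp add: algebra_simps)
qed

lemma powr_diff_le:
  fixes r u w M :: real
  assumes "1 \<le> r" "0 \<le> w" "w \<le> u" "u \<le> M"
  shows "u powr r - w powr r \<le> r * M powr (r - 1) * (u - w)"
proof -
  have "u powr r + r * u powr (r - 1) * (w - u) \<le> w powr r"
    using assms by (intro powr_tangent) auto
  then have "u powr r - w powr r \<le> r * u powr (r - 1) * (u - w)"
    by (simp add: algebra_simps)
  also have "\<dots> \<le> r * M powr (r - 1) * (u - w)"
    using assms by (intro mult_right_mono mult_left_mono powr_mono2) auto
  finally show ?thesis .
qed

text \<open>The second derivative \<open>q * (q - 1) * z powr (q - 2)\<close> is nondecreasing
  because \<open>q >= 2\<close>, so on \<open>[0, M]\<close> it is at most its value at
  \<open>M\<close>.\<close>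

lemma powr_taylor2:
  fixes q u w M :: real
  assumes q: "2 \<le> q" and uw: "0 \<le> u" "0 \<le> w" "u \<le> M" "w \<le> M"
  shows "u powr q \<le> w powr q + q * w powr (q - 1) * (u - w)
           + q * (q - 1) / 2 * M powr (q - 2) * (u - w)\<^sup>2"
proof -
  \<comment> \<open>\<open>F\<close> is the right side minus the left side, with
    \<open>F w = 0\<close>; its derivative \<open>F'\<close> is nonnegative to the right of
    \<open>w\<close> and nonpositive to the left. Differentiability is claimed only for
    \<open>z > 0\<close>; continuity covers the endpoint 0.\<close>
  define F where "F z = w powr q + q * w powr (q - 1) * (z - w)
           + q * (q - 1) / 2 * M powr (q - 2) * (z - w)\<^sup>2 - z powr q" for z
  define F' where "F' z = q * (w powr (q - 1) + (q - 1) * M powr (q - 2) * (z - w) - z powr (q - 1))"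
    for z
  have deriv: "(F has_real_derivative F' z) (at z)" if "z > 0" for z
    unfolding F_def F'_def using that
    by (auto intro!: derivative_eq_intros simp: field_simps power2_eq_square)
  have cont: "continuous_on S F" if "S \<subseteq> {0..}" for S
    unfolding F_def using q that by (auto intro!: continuous_intros continuous_on_powr')
  have "F w \<le> F u"
  proof (cases "w \<le> u")
    case True
    have "F' z \<ge> 0" if "w < z" "z < u" for z
      unfolding F'_def
      using powr_diff_le[of "q - 1" w z M] q uw that by (auto intro!: mult_nonneg_nonneg)
    moreover have "0 < z" if "w < z" for z using that uw by simp
    ultimately have "\<exists>y. (F has_real_derivative y) (at z) \<and> 0 \<le> y" if "w < z" "z < u" for z
      using that deriv by blast
    then show ?thesis
      by (rule DERIV_nonneg_imp_increasing_open[OF True]) (use uw in \<open>auto intro: cont\<close>)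
  next
    case False
    have "F' z \<le> 0" if "u < z" "z < w" for z
    proof -
      have "w powr (q - 1) - z powr (q - 1) \<le> (q - 1) * M powr (q - 2) * (w - z)"
        using powr_diff_le[of "q - 1" z w M] q uw that by auto
      then have "w powr (q - 1) + (q - 1) * M powr (q - 2) * (z - w) - z powr (q - 1) \<le> 0"
        by (simp add: right_diff_distrib)
      then show ?thesis
        unfolding F'_def using q by (intro mult_nonneg_nonpos) auto
    qed
    moreover have "0 < z" if "u < z" for z using that uw by simp
    ultimately have "\<exists>y. (F has_real_derivative y) (at z) \<and> y \<le> 0" if "u < z" "z < w" for z
      using that deriv by blast
    moreover have "u \<le> w" using False by simp
    ultimately show ?thesis
      using DERIV_nonpos_imp_decreasing_open[of u w F] cont[of "{u..w}"] uw by auto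
  qed
  then show ?thesis by (simp add: F_def)
qed

text \<open>Lets the increment \<open>t\<close> cross the kink at 0 without being truncated on the
  right side. For \<open>y <= 0\<close> the linear term vanishes and truncation is a contraction;
  for \<open>y > 0\<close> and \<open>y + t >= 0\<close> nothing is truncated; crossing downwards is
  the remaining case.\<close>

lemma pos_part_powr_taylor2:
  fixes q y t M :: real
  assumes q: "2 \<le> q" and M: "0 < M" "y \<le> M" "y + t \<le> M"
  shows "max 0 (y + t) powr q \<le> max 0 y powr q + q * max 0 y powr (q - 1) * t
           + q * (q - 1) / 2 * M powr (q - 2) * t\<^sup>2"
proof -
  have tay: "max 0 (y + t) powr q \<le> max 0 y powr q + q * max 0 y powr (q - 1) * (max 0 (y + t) - max 0 y)
           + q * (q - 1) / 2 * M powr (q - 2) * (max 0 (y + t) - max 0 y)\<^sup>2"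
    by (rule powr_taylor2) (use assms in auto)
  have k: "0 \<le> q * (q - 1) / 2 * M powr (q - 2)" using q by simp
  consider "y \<le> 0" | "0 < y" "0 \<le> y + t" | "0 < y" "y + t < 0" by linarith
  then show ?thesis
  proof cases
    case 1
    then have "(max 0 (y + t) - max 0 y)\<^sup>2 \<le> t\<^sup>2"
      by (simp add: abs_le_square_iff[symmetric])
    with 1 mult_left_mono[OF this k] tay show ?thesis by simp
  next
    case 2
    with tay show ?thesis by simp
  next
    case 3
    define z where "z = t / y"
    have t: "t = y * z" using 3 by (simp add: z_def)
    have y: "y powr q = y powr (q - 2) * y\<^sup>2" "y powr (q - 1) = y powr (q - 2) * y"
      using 3 by (simp_all add: powr_diff power2_eq_square)
    \<comment> \<open>The left side of the claim is 0 here. With \<open>y\<close> in place of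
      \<open>M\<close> and divided by \<open>y powr q\<close>, the right side is this sum of
      squares, as \<open>q >= 2\<close>; passing from \<open>y\<close> to \<open>M\<close> only
      enlarges it.\<close>
    have "0 \<le> (1 + q / 2 * z)\<^sup>2 + q * (q - 2) / 4 * z\<^sup>2" using q by simp
    also have "\<dots> = 1 + q * z + q * (q - 1) / 2 * z\<^sup>2"
      by (simp add: power2_eq_square field_simps)
    finally have "0 \<le> y powr (q - 2) * y\<^sup>2 * (1 + q * z + q * (q - 1) / 2 * z\<^sup>2)" by simp
    also have "\<dots> = y powr q + q * y powr (q - 1) * t + q * (q - 1) / 2 * y powr (q - 2) * t\<^sup>2"
      unfolding y t by (simp add: power2_eq_square algebra_simps)
    also have "\<dots> \<le> y powr q + q * y powr (q - 1) * t + q * (q - 1) / 2 * M powr (q - 2) * t\<^sup>2"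
      using 3 M q by (intro add_left_mono mult_right_mono mult_left_mono powr_mono2) auto
    finally show ?thesis using 3 by simp
  qed
qed

lemma power2_powr:
  fixes x b :: real
  assumes "0 \<le> x"
  shows "(x\<^sup>2) powr b = x powr (2 * b)"
  using assms by (simp add: powr_powr flip: powr_numeral)

subsection \<open>Bellman functions\<close>

text \<open>
  The argument \<open>r\<close> stands for the squared norm \<open>\<parallel>x\<parallel>\<^sup>2\<close> of the current position and \<open>s\<close> for the
  accumulated conditional variance; \<open>x, u, m\<close> in \<open>jump\<close> are the norms of position and increment and
  their inner product. The variance is increased before the jump, since it is predictable: \<open>jump\<close> is
  applied at the new \<open>s\<close>, and \<open>compensate\<close> pays for the resulting term \<open>A * u\<^sup>2\<close>, whose conditional
  mean is \<open>A * (s' - s)\<close>.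
\<close>
locale bellman =
  fixes q c1 c2 B C k :: real and U g A :: "real \<Rightarrow> real \<Rightarrow> real"
  assumes q: "1 \<le> q"
    and nonneg: "0 \<le> c1" "0 \<le> c2" "0 \<le> B" "0 \<le> C" "0 \<le> k"
    and measurable_U: "case_prod U \<in> borel_measurable (borel \<Otimes>\<^sub>M borel)"
    and measurable_g: "case_prod g \<in> borel_measurable (borel \<Otimes>\<^sub>M borel)"
    and measurable_A: "case_prod A \<in> borel_measurable (borel \<Otimes>\<^sub>M borel)"
    and U_nonneg: "0 \<le> r \<Longrightarrow> 0 \<le> s \<Longrightarrow> 0 \<le> U r s"
    and U_le: "0 \<le> r \<Longrightarrow> 0 \<le> s \<Longrightarrow> U r s \<le> r powr q"
    and g_bound: "0 \<le> x \<Longrightarrow> 0 \<le> s \<Longrightarrow> \<bar>g (x\<^sup>2) s\<bar> * x \<le> k * x powr (2 * q - 1)"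
    and A_nonneg: "0 \<le> r \<Longrightarrow> 0 \<le> s \<Longrightarrow> 0 \<le> A r s"
    and A_bound: "0 \<le> x \<Longrightarrow> 0 \<le> s \<Longrightarrow> A (x\<^sup>2) s \<le> k * (1 + x powr (2 * q - 2))"
    and jump: "0 \<le> x \<Longrightarrow> 0 \<le> u \<Longrightarrow> 0 \<le> s \<Longrightarrow> \<bar>m\<bar> \<le> x * u \<Longrightarrow>
      U (x\<^sup>2 + 2 * m + u\<^sup>2) s \<le> U (x\<^sup>2) s + g (x\<^sup>2) s * m + A (x\<^sup>2) s * u\<^sup>2 + C * u powr (2 * q)"
    and compensate: "0 \<le> r \<Longrightarrow> 0 \<le> s \<Longrightarrow> s \<le> s' \<Longrightarrow>
      U r s' + A r s' * (s' - s) \<le> U r s + B * (s' powr q - s powr q)"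
    and majorant: "0 \<le> r \<Longrightarrow> 0 \<le> s \<Longrightarrow> r powr q \<le> c1 * U r s + c2 * s powr q"

text \<open>For \<open>q = 1\<close> the squared norm itself works: its expansion is exact, and the
  conditional mean of the squared increment is the increment of \<open>s\<close>. The resulting
  bound expresses the orthogonality of martingale increments.\<close>

lemma bellman_square: "bellman 1 1 0 1 0 2 (\<lambda>r _. r) (\<lambda>_ _. 2) (\<lambda>_ _. 1)"
proof
  show "\<bar>2\<bar> * x \<le> 2 * x powr (2 * 1 - 1)" if "0 \<le> x" for x :: real
    using that by simp
qed (auto simp: powr_one_gt_zero_iff)

section \<open>Truncated squares, for exponents \<open>1 < q <= 2\<close>\<close>

text \<open>\<open>z powr (- b)\<close> is convex in \<open>b\<close>, and the bound is its chord
  between \<open>b = 0\<close> and \<open>b = 1\<close>. It replaces a real power by a rational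
  function.\<close>

lemma inverse_powr_le_chord:
  fixes b z :: real
  assumes "0 \<le> b" "b \<le> 1" "0 < z"
  shows "z powr (- b) \<le> 1 - b + b / z"
proof -
  have "(1 / z) powr b * 1 powr (1 - b) \<le> b * (1 / z) + (1 - b) * 1"
    using assms by (intro Youngs_inequality_0) auto
  then show ?thesis using assms by (simp add: powr_minus_divide powr_divide)
qed

text \<open>Normalised to \<open>r = 1\<close>: \<open>b\<close> stands for \<open>2 - q\<close>,
  \<open>z\<close> for \<open>max 0 (r - a) / r\<close>, and \<open>t\<close> for the relative
  change of the squared norm. The linear coefficient is the derivative at \<open>t = 0\<close>. A
  jump of at most a quarter of the norm multiplies its square by a factor between
  \<open>9/16 = 1 - 7/16\<close> and \<open>25/16 = 1 + 9/16\<close>, whence the range of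
  \<open>t\<close>.\<close>

lemma truncated_square_expansion:
  fixes b t z :: real
  assumes b: "0 \<le> b" "b \<le> 1" and t: "-(7/16) \<le> t" "t \<le> 9/16" and z: "0 \<le> z" "z \<le> 1"
  shows "(1 + t) powr (- b) * (z + t)\<^sup>2 \<le> z\<^sup>2 + (2 * z - b * z\<^sup>2) * t + 6 * t\<^sup>2"
proof -
  define P where "P = 1 - b * t + 16/9 * b * t\<^sup>2"
  have "(1 + t) powr (- b) \<le> 1 - b + b / (1 + t)"
    using assms by (intro inverse_powr_le_chord) auto
  also have "\<dots> = 1 - b * t + b * (t\<^sup>2 / (1 + t))"
    using t by (simp add: field_simps power2_eq_square)
  also have "t\<^sup>2 / (1 + t) \<le> t\<^sup>2 / (9/16)"
    using t by (intro divide_left_mono) auto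
  finally have P: "(1 + t) powr (- b) \<le> P"
    using b by (simp add: P_def mult_left_mono)
  have abs_t: "\<bar>t\<bar> \<le> 9/16" and t2: "t\<^sup>2 \<le> 81/256"
    using t power_mono[of "\<bar>t\<bar>" "9/16" 2] by (auto simp: power2_eq_square)
  have "P \<le> 1 + 7/16 + 16/9 * (81/256)"
  proof -
    have "- (b * t) \<le> 7/16"
    proof (cases "0 \<le> t")
      case True
      then have "0 \<le> b * t" using b by simp
      then show ?thesis by linarith
    next
      case False
      then show ?thesis using b t mult_mono[of b 1 "-t" "7/16"] by auto
    qed
    moreover have "b * t\<^sup>2 \<le> 81/256"
      using b t2 mult_mono[of b 1 "t\<^sup>2" "81/256"] by auto
    ultimately show ?thesis by (simp add: P_def)
  qed
  then have P2: "P \<le> 2" by simp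
  have bz: "b * z \<le> 1" "b * z\<^sup>2 \<le> 1"
    using b z mult_mono[of b 1 z 1] mult_mono[of b 1 "z\<^sup>2" 1] by (auto simp: power_le_one)
  have "b * z * t \<le> b * z * \<bar>t\<bar>"
    using b z by (intro mult_left_mono) auto
  also have "\<dots> \<le> 1 * (9/16)"
    using bz b z abs_t by (intro mult_mono) auto
  finally have "b * z * t \<le> 1 * (9/16)" .
  \<comment> \<open>The left side is the coefficient of \<open>t\<^sup>2\<close> once the terms of
    order 0 and 1 are split off from \<open>P * (z + t)\<^sup>2\<close>. It is at most
    \<open>16/9 + 2 + 2\<close>, hence the constant 6.\<close>
  then have c: "16/9 * (b * z\<^sup>2) - 2 * (b * z) + 32/9 * (b * z * t) + P \<le> 6"
    using bz P2 mult_nonneg_nonneg[OF b(1) z(1)] by linarith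
  have "(1 + t) powr (- b) * (z + t)\<^sup>2 \<le> P * (z + t)\<^sup>2"
    using P by (intro mult_right_mono) auto
  also have "\<dots> = z\<^sup>2 + (2 * z - b * z\<^sup>2) * t
      + (16/9 * (b * z\<^sup>2) - 2 * (b * z) + 32/9 * (b * z * t) + P) * t\<^sup>2"
    unfolding P_def by (simp add: power2_eq_square algebra_simps)
  also have "\<dots> \<le> z\<^sup>2 + (2 * z - b * z\<^sup>2) * t + 6 * t\<^sup>2"
    using c by (intro add_left_mono mult_right_mono) auto
  finally show ?thesis .
qed

text \<open>The preceding expansion rescaled by \<open>r\<close>, with \<open>b = 2 - q\<close>.
  Squaring absorbs the kink: the new truncated value is at most
  \<open>\<bar>r * z + r * t\<bar>\<close>, whatever the sign of \<open>r - a\<close>.\<close>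

lemma truncated_square_step:
  fixes q a r t :: real
  assumes q: "1 \<le> q" "q \<le> 2" and r: "0 < r" and a: "0 \<le> a"
    and t: "-(7/16) \<le> t" "t \<le> 9/16"
  shows "(r + r * t) powr (q - 2) * (max 0 (r + r * t - a))\<^sup>2 \<le>
     r powr (q - 2) * (max 0 (r - a))\<^sup>2
     + r powr (q - 2) * (2 * max 0 (r - a) - (2 - q) * (max 0 (r - a))\<^sup>2 / r) * (r * t)
     + 6 * r powr q * t\<^sup>2"
proof -
  define z where "z = max 0 (r - a) / r"
  have z: "0 \<le> z" "z \<le> 1" "max 0 (r - a) = r * z"
    using r a by (auto simp: z_def field_simps)
  have powr: "(r + r * t) powr (q - 2) = r powr (q - 2) * (1 + t) powr (- (2 - q))"
    using r t powr_mult[of r "1 + t" "q - 2"] by (simp add: distrib_left)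
  have "max 0 (r + r * t - a) \<le> \<bar>r * z + r * t\<bar>"
    unfolding z(3)[symmetric] by auto
  then have "(max 0 (r + r * t - a))\<^sup>2 \<le> \<bar>r * z + r * t\<bar>\<^sup>2"
    by (intro power_mono) auto
  also have "\<dots> = r\<^sup>2 * (z + t)\<^sup>2"
    by (simp add: power2_eq_square algebra_simps)
  finally have "(r + r * t) powr (q - 2) * (max 0 (r + r * t - a))\<^sup>2
      \<le> (r + r * t) powr (q - 2) * (r\<^sup>2 * (z + t)\<^sup>2)"
    by (intro mult_left_mono) auto
  also have "(r + r * t) powr (q - 2) * (r\<^sup>2 * (z + t)\<^sup>2)
      = r powr (q - 2) * r\<^sup>2 * ((1 + t) powr (- (2 - q)) * (z + t)\<^sup>2)"
    by (simp only: powr mult_ac)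
  also have "\<dots> \<le> r powr (q - 2) * r\<^sup>2 * (z\<^sup>2 + (2 * z - (2 - q) * z\<^sup>2) * t + 6 * t\<^sup>2)"
    using q t z by (intro mult_left_mono truncated_square_expansion) auto
  also have "\<dots> = r powr (q - 2) * (r * z)\<^sup>2
      + r powr (q - 2) * (2 * (r * z) - (2 - q) * (r * z)\<^sup>2 / r) * (r * t)
      + 6 * (r powr (q - 2) * r\<^sup>2) * t\<^sup>2"
    using r by (simp add: power2_eq_square field_simps)
  also have "r powr (q - 2) * r\<^sup>2 = r powr q"
    using r by (simp add: powr_diff)
  finally show ?thesis by (simp only: z(3))
qed

lemma abs_le_prod_sum_square_nonneg:
  fixes x u m :: real
  assumes "\<bar>m\<bar> \<le> x * u"
  shows "0 \<le> x\<^sup>2 + 2 * m + u\<^sup>2" "x\<^sup>2 + 2 * m + u\<^sup>2 \<le> (x + u)\<^sup>2"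
proof -
  have "0 \<le> (x - u)\<^sup>2" by simp
  then show "0 \<le> x\<^sup>2 + 2 * m + u\<^sup>2" "x\<^sup>2 + 2 * m + u\<^sup>2 \<le> (x + u)\<^sup>2"
    using assms unfolding power2_diff power2_sum by linarith+
qed

text \<open>Here \<open>x <= u / th\<close>, so \<open>u\<close> controls everything. The new norm
  is at most \<open>(1 + 1 / th) * u\<close>, which gives the first summand of the constant; the
  linear term \<open>G * m\<close> gives the second.\<close>

lemma big_jump:
  fixes q x u m th k G :: real
  assumes q: "1 \<le> q" and th: "0 < th" and x: "0 \<le> x" and u: "th * x \<le> u" and m: "\<bar>m\<bar> \<le> x * u"
    and k: "0 \<le> k" and K: "\<bar>G\<bar> * x \<le> k * x powr (2 * q - 1)"
  shows "(x\<^sup>2 + 2 * m + u\<^sup>2) powr q - G * m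
      \<le> ((1 + 1 / th) powr (2 * q) + k * th powr (1 - 2 * q)) * u powr (2 * q)"
proof -
  have u0: "0 \<le> u" using u x th by (meson mult_nonneg_nonneg less_imp_le order_trans)
  have xu: "x \<le> u / th" using u th by (simp add: field_simps)
  have "(x\<^sup>2 + 2 * m + u\<^sup>2) powr q \<le> ((x + u)\<^sup>2) powr q"
    using abs_le_prod_sum_square_nonneg[OF m] q by (intro powr_mono2) auto
  also have "\<dots> = (x + u) powr (2 * q)"
    using x u0 by (simp add: powr_powr flip: powr_numeral)
  also have "\<dots> \<le> ((1 + 1 / th) * u) powr (2 * q)"
    using xu x u0 q by (intro powr_mono2) (auto simp: algebra_simps)
  also have "\<dots> = (1 + 1 / th) powr (2 * q) * u powr (2 * q)"
    using th u0 by (simp add: powr_mult)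
  finally have 1: "(x\<^sup>2 + 2 * m + u\<^sup>2) powr q \<le> (1 + 1 / th) powr (2 * q) * u powr (2 * q)" .
  have "- G * m \<le> \<bar>G\<bar> * \<bar>m\<bar>"
    by (metis abs_ge_self abs_mult abs_minus_cancel)
  also have "\<dots> \<le> \<bar>G\<bar> * (x * u)"
    using m by (intro mult_left_mono) auto
  also have "\<dots> = (\<bar>G\<bar> * x) * u" by simp
  also have "\<dots> \<le> (k * x powr (2 * q - 1)) * u"
    using K u0 by (intro mult_right_mono) auto
  also have "\<dots> \<le> (k * (u / th) powr (2 * q - 1)) * u"
    using xu x q u0 k by (intro mult_right_mono mult_left_mono powr_mono2) auto
  also have "\<dots> = k * th powr (1 - 2 * q) * u powr (2 * q)"
    using th u0 by (cases "u = 0") (auto simp: powr_divide powr_diff field_simps)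
  finally show ?thesis using 1 by (simp add: algebra_simps)
qed

text \<open>
  For \<open>q < 2\<close> the function \<open>max 0 (r - c * s) powr q\<close> used below for \<open>q \<ge> 2\<close> does not work, because
  its second derivative is unbounded near \<open>r = c * s\<close>. Squaring the positive part cures this, and the
  factor \<open>r powr (q - 2)\<close> restores the homogeneity; it is harmless, being smooth on \<open>r \<ge> c * s\<close>.
\<close>
lemma bellman_truncated_square:
  fixes q :: real
  assumes q: "1 < q" "q \<le> 2"
  shows "bellman q 4 (66 powr q) (33 * 66 powr (q - 1)) (25 powr q + 16 powr q) 33
    (\<lambda>r s. r powr (q - 2) * (max 0 (r - 33 * s))\<^sup>2)
    (\<lambda>r s. 2 * (r powr (q - 2) * (2 * max 0 (r - 33 * s) - (2 - q) * (max 0 (r - 33 * s))\<^sup>2 / r)))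
    (\<lambda>r s. 33 * r powr (q - 1))" (is "bellman _ _ _ _ _ _ ?U ?g ?A")
proof
  \<comment> \<open>For \<open>r > 0\<close> this is the derivative of \<open>?U\<close> in
    \<open>r\<close>; \<open>?g\<close> is twice as large because the squared norm changes by
    \<open>2 * m\<close> to first order.\<close>
  let ?h = "\<lambda>r s. r powr (q - 2) * (2 * max 0 (r - 33 * s) - (2 - q) * (max 0 (r - 33 * s))\<^sup>2 / r)"
  have h: "0 \<le> ?h r s" "?h r s \<le> 2 * r powr (q - 1)" if "0 \<le> r" "0 \<le> s" for r s
  proof -
    define y where "y = max 0 (r - 33 * s)"
    have y: "0 \<le> y" "y \<le> r" using that by (auto simp: y_def)
    have "0 \<le> ?h r s \<and> ?h r s \<le> 2 * r powr (q - 1)"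
    proof (cases "r = 0")
      case False
      then have r: "r > 0" using that by simp
      have "(2 - q) * (y\<^sup>2 / r) \<le> 1 * (y * 1)"
        using q y r mult_right_mono[of y r y]
        by (intro mult_mono) (auto simp: power2_eq_square field_simps)
      moreover have "0 \<le> (2 - q) * (y\<^sup>2 / r)" using q r by simp
      ultimately have *: "0 \<le> 2 * y - (2 - q) * y\<^sup>2 / r" "2 * y - (2 - q) * y\<^sup>2 / r \<le> 2 * r"
        using y by auto
      have "r powr (q - 2) * (2 * y - (2 - q) * y\<^sup>2 / r) \<le> r powr (q - 2) * (2 * r)"
        using * by (intro mult_left_mono) auto
      also have "\<dots> = 2 * r powr (q - 1)"
        using r by (simp add: powr_diff power2_eq_square)
      finally show ?thesis using * unfolding y_def by auto
    qed simp
    then show "0 \<le> ?h r s" "?h r s \<le> 2 * r powr (q - 1)" by auto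
  qed
  \<comment> \<open>The common bound \<open>k = 33\<close> also has to cover \<open>?A\<close>; the
    sharper 4 is kept for \<open>big_jump\<close>, where it enters the cost of large jumps.\<close>
  have gb: "\<bar>?g (x\<^sup>2) s\<bar> * x \<le> 4 * x powr (2 * q - 1)" if "0 \<le> x" "0 \<le> s" for x s
  proof -
    have "\<bar>?g (x\<^sup>2) s\<bar> * x \<le> (4 * x powr (2 * (q - 1))) * x"
      using h[of "x\<^sup>2" s] that by (intro mult_right_mono) (auto simp: power2_powr)
    also have "\<dots> = 4 * x powr (2 * q - 1)"
      using that by (cases "x = 0") (auto simp: powr_diff power2_eq_square algebra_simps)
    finally show ?thesis .
  qed
  show "\<bar>?g (x\<^sup>2) s\<bar> * x \<le> 33 * x powr (2 * q - 1)" if "0 \<le> x" "0 \<le> s" for x s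
    using gb[OF that] by (rule order_trans) simp
  show "33 * x\<^sup>2 powr (q - 1) \<le> 33 * (1 + x powr (2 * q - 2))" if "0 \<le> x" "0 \<le> s" for x s :: real
    using that by (simp add: power2_powr algebra_simps)
  show "?U r s \<le> r powr q" if "0 \<le> r" "0 \<le> s" for r s
  proof -
    have "?U r s \<le> r powr (q - 2) * r\<^sup>2"
      using that by (intro mult_left_mono power_mono) auto
    also have "\<dots> \<le> r powr q"
      using that by (cases "r = 0") (auto simp: powr_diff)
    finally show ?thesis .
  qed
  show "?U (x\<^sup>2 + 2 * m + u\<^sup>2) s
      \<le> ?U (x\<^sup>2) s + ?g (x\<^sup>2) s * m + ?A (x\<^sup>2) s * u\<^sup>2 + (25 powr q + 16 powr q) * u powr (2 * q)"
    if x: "0 \<le> x" and u: "0 \<le> u" and s: "0 \<le> s" and m: "\<bar>m\<bar> \<le> x * u" for x u s m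
  \<comment> \<open>Jumps of at least a quarter of the norm go to \<open>big_jump\<close> with
    \<open>th = 1/4\<close>; its two summands are \<open>25 powr q\<close> and
    \<open>16 powr q\<close>.\<close>
  proof (cases "1/4 * x \<le> u")
    case True
    have "?U (x\<^sup>2 + 2 * m + u\<^sup>2) s \<le> (x\<^sup>2 + 2 * m + u\<^sup>2) powr q"
    proof -
      define w where "w = x\<^sup>2 + 2 * m + u\<^sup>2"
      have w: "0 \<le> w" unfolding w_def using abs_le_prod_sum_square_nonneg[OF m] by simp
      then have "?U w s \<le> w powr (q - 2) * w\<^sup>2"
        using s by (intro mult_left_mono power_mono) auto
      also have "\<dots> \<le> w powr q"
        using w by (cases "w = 0") (auto simp: powr_diff)
      finally show ?thesis by (simp add: w_def)
    qed
    moreover have "(x\<^sup>2 + 2 * m + u\<^sup>2) powr q - ?g (x\<^sup>2) s * m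
      \<le> ((1 + 1 / (1/4)) powr (2 * q) + 4 * (1/4) powr (1 - 2 * q)) * u powr (2 * q)"
      using q x True m gb[OF x s] by (intro big_jump) auto
    moreover have "(1 + 1 / (1/4::real)) powr (2 * q) = 25 powr q"
      using power2_powr[of 5 q] by simp
    moreover have "4 * (1/4::real) powr (1 - 2 * q) = 16 powr q"
      using power2_powr[of 4 q] by (simp add: powr_divide powr_diff)
    moreover have "0 \<le> ?U (x\<^sup>2) s" "0 \<le> ?A (x\<^sup>2) s * u\<^sup>2" by auto
    ultimately show ?thesis by (simp only:)
  next
    case False
    then have x0: "0 < x" using x u by (cases "x = 0") auto
    define t where "t = (2 * m + u\<^sup>2) / x\<^sup>2"
    have xt: "x\<^sup>2 * t = 2 * m + u\<^sup>2" using x0 by (simp add: t_def)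
    have xu: "x * u \<le> 1/4 * x\<^sup>2" "u\<^sup>2 \<le> 1/4 * (x * u)"
      using False x0 u mult_left_mono[of "4 * u" x x] mult_right_mono[of "4 * u" x u]
      by (auto simp: power2_eq_square)
    have "(x - u)\<^sup>2 \<ge> (3/4 * x)\<^sup>2"
      using False x0 by (intro power_mono) auto
    then have "x\<^sup>2 + 2 * m + u\<^sup>2 \<ge> 9/16 * x\<^sup>2"
      using m by (simp add: power2_diff power_mult_distrib power_divide)
    then have t1: "-(7/16) \<le> t"
      using x0 by (simp add: t_def field_simps)
    have t2: "t \<le> 9/16"
      using m xu x0 by (simp add: t_def field_simps)
    have "\<bar>2 * m + u\<^sup>2\<bar> \<le> 9/4 * (x * u)"
      using m xu zero_le_power2[of u] by linarith
    then have "\<bar>x\<^sup>2 * t\<bar>\<^sup>2 \<le> (9/4 * (x * u))\<^sup>2"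
      unfolding xt by (intro power_mono) auto
    also have "\<dots> = (81/16 * u\<^sup>2) * x\<^sup>2"
      by (simp add: power_mult_distrib power_divide)
    also have "\<bar>x\<^sup>2 * t\<bar>\<^sup>2 = (x\<^sup>2 * t\<^sup>2) * x\<^sup>2"
      by (simp add: power2_eq_square)
    finally have tt: "x\<^sup>2 * t\<^sup>2 \<le> 81/16 * u\<^sup>2"
      using x0 by (simp only: mult_le_cancel_right) auto
    have "?U (x\<^sup>2 + x\<^sup>2 * t) s \<le> ?U (x\<^sup>2) s + ?h (x\<^sup>2) s * (x\<^sup>2 * t) + 6 * (x\<^sup>2) powr q * t\<^sup>2"
      using q x0 t1 t2 s by (intro truncated_square_step) auto
    also have "(x\<^sup>2) powr q = (x\<^sup>2) powr (q - 1) * x\<^sup>2"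
      using x0 by (simp add: powr_diff)
    also have "6 * ((x\<^sup>2) powr (q - 1) * x\<^sup>2) * t\<^sup>2 = 6 * (x\<^sup>2) powr (q - 1) * (x\<^sup>2 * t\<^sup>2)"
      by simp
    also have "\<dots> \<le> 6 * (x\<^sup>2) powr (q - 1) * (81/16 * u\<^sup>2)"
      using tt by (intro mult_left_mono) auto
    also have "?h (x\<^sup>2) s * (x\<^sup>2 * t) = ?g (x\<^sup>2) s * m + ?h (x\<^sup>2) s * u\<^sup>2"
      unfolding xt distrib_left by (simp only: mult_ac)
    also have "?h (x\<^sup>2) s * u\<^sup>2 \<le> 2 * (x\<^sup>2) powr (q - 1) * u\<^sup>2"
      using h s by (intro mult_right_mono) auto
    finally have *: "?U (x\<^sup>2 + (2 * m + u\<^sup>2)) s \<le> ?U (x\<^sup>2) s + (?g (x\<^sup>2) s * m + 2 * (x\<^sup>2) powr (q - 1) * u\<^sup>2)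
        + 6 * (x\<^sup>2) powr (q - 1) * (81/16 * u\<^sup>2)"
      unfolding xt by simp
    \<comment> \<open>The total coefficient \<open>2 + 6 * 81/16 = 32.375\<close> explains the 33 in
      \<open>?A\<close>. The truncation level uses the same 33, so that the decrease of
      \<open>?U\<close> in \<open>s\<close> can absorb \<open>?A\<close>.\<close>
    have "2 * (x\<^sup>2) powr (q - 1) * u\<^sup>2 + 6 * (x\<^sup>2) powr (q - 1) * (81/16 * u\<^sup>2) \<le> ?A (x\<^sup>2) s * u\<^sup>2"
      by (simp add: mult_ac)
    moreover have "0 \<le> (25 powr q + 16 powr q) * u powr (2 * q)" by auto
    moreover have "U' \<le> U + G + a + b" if "U' \<le> U + (G + a1) + a2" "a1 + a2 \<le> a" "0 \<le> b"
      for U' U G a1 a2 a b :: real using that by linarith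
    ultimately show ?thesis using * unfolding add.assoc[of "x\<^sup>2" "2 * m"] by blast
  qed
  show "?U r s' + ?A r s' * (s' - s) \<le> ?U r s + 33 * 66 powr (q - 1) * (s' powr q - s powr q)"
    if r: "0 \<le> r" and s: "0 \<le> s" "s \<le> s'" for r s s'
  proof (cases "66 * s' \<le> r \<and> r \<noteq> 0")
    case True
    then have r0: "r > 0" using r by simp
    \<comment> \<open>The threshold \<open>66 * s' <= r\<close> makes the last factor at least
      \<open>r\<close>, so the decrease of \<open>?U\<close> pays for \<open>?A\<close> completely.
      Below the threshold \<open>r\<close> is at most \<open>66 * s'\<close>, and the increase of
      \<open>s powr q\<close> pays instead.\<close>
    have "(r - 33 * s)\<^sup>2 - (r - 33 * s')\<^sup>2 = 33 * (s' - s) * (2 * r - 33 * s - 33 * s')"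
      by (simp add: power2_eq_square algebra_simps)
    also have "\<dots> \<ge> 33 * (s' - s) * r"
      using True s by (intro mult_left_mono) auto
    finally have "(r - 33 * s')\<^sup>2 + 33 * (s' - s) * r \<le> (r - 33 * s)\<^sup>2" by simp
    then have "r powr (q - 2) * ((r - 33 * s')\<^sup>2 + 33 * (s' - s) * r) \<le> r powr (q - 2) * (r - 33 * s)\<^sup>2"
      by (intro mult_left_mono) auto
    moreover have "r powr (q - 2) * (33 * (s' - s) * r) = ?A r s' * (s' - s)"
      using r0 by (simp add: powr_diff power2_eq_square)
    moreover have "max 0 (r - 33 * s') = r - 33 * s'" "max 0 (r - 33 * s) = r - 33 * s"
      using True s by auto
    moreover have "0 \<le> 33 * 66 powr (q - 1) * (s' powr q - s powr q)"
      using s q by (auto intro!: mult_nonneg_nonneg powr_mono2)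
    ultimately show ?thesis by (simp add: distrib_left mult_ac)
  next
    case False
    then have "r powr (q - 1) \<le> (66 * s') powr (q - 1)"
      using r s q by (intro powr_mono2) auto
    then have "?A r s' * (s' - s) \<le> 33 * (66 * s') powr (q - 1) * (s' - s)"
      using s by (intro mult_right_mono) auto
    also have "\<dots> = 33 * 66 powr (q - 1) * (s' powr (q - 1) * (s' - s))"
      using s by (simp add: powr_mult)
    also have "\<dots> \<le> 33 * 66 powr (q - 1) * (s' powr q - s powr q)"
      using s q by (intro mult_left_mono diff_powr_ge) auto
    finally have "?A r s' * (s' - s) \<le> 33 * 66 powr (q - 1) * (s' powr q - s powr q)" .
    moreover have "?U r s' \<le> ?U r s"
      using s by (intro mult_left_mono power_mono) auto
    ultimately show ?thesis by linarith
  qed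
  show "r powr q \<le> 4 * ?U r s + 66 powr q * s powr q" if r: "0 \<le> r" and s: "0 \<le> s" for r s
  proof (cases "66 * s \<le> r \<and> r \<noteq> 0")
    case True
    then have "(r / 2)\<^sup>2 \<le> (max 0 (r - 33 * s))\<^sup>2"
      using s by (intro power_mono) auto
    then have "r powr (q - 2) * (r / 2)\<^sup>2 \<le> ?U r s"
      by (intro mult_left_mono) auto
    moreover have "r powr q = r powr (q - 2) * r\<^sup>2"
      using True r by (simp add: powr_diff)
    moreover have "0 \<le> 66 powr q * s powr q" by simp
    ultimately show ?thesis by (simp add: power_divide mult_ac add_increasing2)
  next
    case False
    then have "r powr q \<le> (66 * s) powr q"
      using r s q by (intro powr_mono2) auto
    also have "\<dots> = 66 powr q * s powr q" using s by (simp add: powr_mult)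
    finally show ?thesis by (simp add: add_increasing)
  qed
qed (use q in auto)

section \<open>Truncated powers, for exponents \<open>q >= 2\<close>\<close>

text \<open>
  If \<open>\<parallel>d\<parallel> \<le> th * \<parallel>x\<parallel>\<close> and \<open>r - c * s \<ge> 4/5 * r\<close>, then moving from \<open>x\<close> to \<open>x + d\<close> multiplies \<open>r - c * s\<close>
  by at most \<open>jump_factor th\<close>. The speed \<open>c = slope q th\<close> is the one for which the decrease of
  \<open>max 0 (r - c * s) powr q\<close> in \<open>s\<close> absorbs the second-order Taylor term of such a jump.
\<close>
definition jump_factor :: "real \<Rightarrow> real" where
  "jump_factor th = 1 + 5/4 * (2 * th + th\<^sup>2)"

definition slope :: "real \<Rightarrow> real \<Rightarrow> real" where
  "slope q th = 1 + 5/8 * (q - 1) * (2 + th)\<^sup>2 * jump_factor th powr (q - 2)"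

text \<open>\<open>y\<close> stands for \<open>r - c * s\<close>, which may be small or negative,
  and \<open>y0\<close> for an upper bound that dominates a multiple of \<open>x\<^sup>2\<close>.
  The Taylor bound is used with \<open>M = jump_factor th * y0\<close>. The \<open>u\<^sup>2\<close>
  part of its linear term yields the summand 1 of \<open>slope\<close>, its quadratic term the other
  summand.\<close>

lemma truncated_power_jump:
  fixes q th x u m y y0 :: real
  assumes q: "2 \<le> q" and th: "0 < th" and x: "0 < x" and u: "0 \<le> u" "u \<le> th * x"
    and m: "\<bar>m\<bar> \<le> x * u" and y: "y \<le> y0" "4/5 * x\<^sup>2 \<le> y0"
  shows "max 0 (y + (2 * m + u\<^sup>2)) powr q \<le> max 0 y powr q + 2 * q * max 0 y powr (q - 1) * m
           + q * slope q th * y0 powr (q - 1) * u\<^sup>2"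
proof -
  define T where "T = jump_factor th"
  define t where "t = 2 * m + u\<^sup>2"
  have "0 < x\<^sup>2" using x by simp
  then have y0: "0 < y0" using y by linarith
  have T: "1 \<le> T" using th by (simp add: T_def jump_factor_def)
  have xu: "x * u \<le> th * x\<^sup>2" "u\<^sup>2 \<le> th * (x * u)"
    using x u mult_left_mono[of u "th * x" x] mult_right_mono[of u "th * x" u]
    by (auto simp: power2_eq_square)
  have t: "\<bar>t\<bar> \<le> (2 + th) * (x * u)"
    using m xu zero_le_power2[of u] unfolding t_def distrib_right by linarith
  also have "\<dots> \<le> (2 + th) * (th * x\<^sup>2)"
    using xu th by (intro mult_left_mono) auto
  also have "\<dots> = (2 * th + th\<^sup>2) * x\<^sup>2" by (simp add: power2_eq_square algebra_simps)
  also have "\<dots> \<le> (2 * th + th\<^sup>2) * (5/4 * y0)"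
    using y th by (intro mult_left_mono) auto
  finally have yt: "y + t \<le> T * y0"
    using y(1) unfolding T_def jump_factor_def by (simp add: algebra_simps)
  have "y \<le> T * y0" using mult_right_mono[OF T less_imp_le[OF y0]] y(1) by linarith
  then have "max 0 (y + t) powr q \<le> max 0 y powr q + q * max 0 y powr (q - 1) * t
           + q * (q - 1) / 2 * (T * y0) powr (q - 2) * t\<^sup>2"
    using q y0 y yt T by (intro pos_part_powr_taylor2) auto
  also have "q * max 0 y powr (q - 1) * t
      = 2 * q * max 0 y powr (q - 1) * m + q * max 0 y powr (q - 1) * u\<^sup>2"
    by (simp add: t_def algebra_simps)
  also have "q * max 0 y powr (q - 1) * u\<^sup>2 \<le> q * y0 powr (q - 1) * u\<^sup>2"
    using q y y0 by (intro mult_right_mono mult_left_mono powr_mono2) auto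
  also have "q * (q - 1) / 2 * (T * y0) powr (q - 2) * t\<^sup>2
      \<le> q * (q - 1) / 2 * (T * y0) powr (q - 2) * ((2 + th)\<^sup>2 * (5/4 * y0 * u\<^sup>2))"
  proof (intro mult_left_mono)
    have "\<bar>t\<bar>\<^sup>2 \<le> ((2 + th) * (x * u))\<^sup>2"
      using t by (intro power_mono) auto
    also have "\<dots> = (2 + th)\<^sup>2 * (x\<^sup>2 * u\<^sup>2)" by (simp add: power_mult_distrib)
    also have "\<dots> \<le> (2 + th)\<^sup>2 * (5/4 * y0 * u\<^sup>2)"
      using y by (intro mult_left_mono mult_right_mono) auto
    finally show "t\<^sup>2 \<le> (2 + th)\<^sup>2 * (5/4 * y0 * u\<^sup>2)" by simp
  qed (use q in auto)
  also have "\<dots> = q * (5/8 * (q - 1) * (2 + th)\<^sup>2 * T powr (q - 2)) * (y0 powr (q - 2) * y0) * u\<^sup>2"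
    using T y0 by (simp add: powr_mult)
  also have "y0 powr (q - 2) * y0 = y0 powr (q - 1)"
    using y0 by (simp add: powr_diff power2_eq_square)
  finally show ?thesis
    unfolding t_def slope_def T_def[symmetric] by (simp add: algebra_simps)
qed

lemma slope_ge_1: "2 \<le> q \<Longrightarrow> 1 \<le> slope q th"
  by (simp add: slope_def)

text \<open>Where \<open>5 * c * s <= r\<close>, the function \<open>A\<close> is minus the
  derivative of \<open>U\<close> in \<open>s\<close>, and the tangent inequality gives
  \<open>compensate\<close> without help from \<open>B\<close>. Elsewhere \<open>4/5 * r\<close> is
  less than \<open>4 * c * s\<close> and the increase of \<open>s powr q\<close> pays, which fixes
  \<open>B\<close>. The same threshold gives \<open>r <= 5/4 * (r - c * s)\<close> in
  \<open>majorant\<close>.\<close>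

lemma bellman_truncated_power:
  fixes q th :: real
  assumes q: "2 \<le> q" and th: "0 < th"
  defines "c \<equiv> slope q th"
  shows "bellman q ((5/4) powr q) ((5 * c) powr q) (q * c * (4 * c) powr (q - 1))
    ((1 + 1 / th) powr (2 * q) + 2 * q * th powr (1 - 2 * q)) (2 * q * c)
    (\<lambda>r s. max 0 (r - c * s) powr q)
    (\<lambda>r s. 2 * q * max 0 (r - c * s) powr (q - 1))
    (\<lambda>r s. q * c * (if 5 * c * s \<le> r then max 0 (r - c * s) else 4/5 * r) powr (q - 1))"
    (is "bellman _ _ _ ?B ?C _ ?U ?g ?A")
proof
  have c: "1 \<le> c" unfolding c_def using q by (rule slope_ge_1)
  have qc: "q \<le> q * c" using q c by simp
  have Ab: "(if 5 * c * s \<le> r then max 0 (r - c * s) else 4/5 * r) powr (q - 1) \<le> r powr (q - 1)"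
    if "0 \<le> r" "0 \<le> s" for r s
    using that c q by (intro powr_mono2) auto
  have gb: "\<bar>?g (x\<^sup>2) s\<bar> * x \<le> 2 * q * x powr (2 * q - 1)" if "0 \<le> x" "0 \<le> s" for x s
  proof -
    have "\<bar>?g (x\<^sup>2) s\<bar> * x \<le> (2 * q * (x\<^sup>2) powr (q - 1)) * x"
      using q that c by (auto intro!: mult_right_mono powr_mono2 simp: abs_mult)
    also have "\<dots> = 2 * q * x powr (2 * q - 1)"
      using that power2_powr[of x "q - 1"] by (cases "x = 0") (auto simp: powr_diff power2_eq_square right_diff_distrib)
    finally show ?thesis .
  qed
  show "\<bar>?g (x\<^sup>2) s\<bar> * x \<le> 2 * q * c * x powr (2 * q - 1)" if "0 \<le> x" "0 \<le> s" for x s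
    using gb[OF that] by (rule order_trans) (rule mult_right_mono, use qc in linarith, simp)
  show "?A (x\<^sup>2) s \<le> 2 * q * c * (1 + x powr (2 * q - 2))" if "0 \<le> x" "0 \<le> s" for x s
  proof -
    have "?A (x\<^sup>2) s \<le> q * c * (x\<^sup>2) powr (q - 1)"
      using Ab[of "x\<^sup>2" s] that q c by (intro mult_left_mono) auto
    also have "(x\<^sup>2) powr (q - 1) = x powr (2 * q - 2)"
      using that by (simp add: power2_powr algebra_simps)
    also have "q * c * x powr (2 * q - 2) \<le> 2 * q * c * (1 + x powr (2 * q - 2))"
      using q c by (intro mult_mono) auto
    finally show ?thesis .
  qed
  show "?U r s \<le> r powr q" if "0 \<le> r" "0 \<le> s" for r s
    using that q c by (intro powr_mono2) auto
  show "?U (x\<^sup>2 + 2 * m + u\<^sup>2) s \<le> ?U (x\<^sup>2) s + ?g (x\<^sup>2) s * m + ?A (x\<^sup>2) s * u\<^sup>2 + ?C * u powr (2 * q)"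
    if x: "0 \<le> x" and u: "0 \<le> u" and s: "0 \<le> s" and m: "\<bar>m\<bar> \<le> x * u" for x u s m
  proof (cases "th * x \<le> u")
    case True
    have "?U (x\<^sup>2 + 2 * m + u\<^sup>2) s \<le> (x\<^sup>2 + 2 * m + u\<^sup>2) powr q"
      using q c s abs_le_prod_sum_square_nonneg[OF m] by (intro powr_mono2) auto
    moreover have "(x\<^sup>2 + 2 * m + u\<^sup>2) powr q - ?g (x\<^sup>2) s * m \<le> ?C * u powr (2 * q)"
      using q x True m gb[OF x s] th by (intro big_jump) auto
    moreover have "0 \<le> ?U (x\<^sup>2) s" "0 \<le> ?A (x\<^sup>2) s * u\<^sup>2" using q c by auto
    ultimately show ?thesis by (simp only:)
  next
    case False
    then have x0: "0 < x" using x u by (cases "x = 0") auto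
    define y0 where "y0 = (if 5 * c * s \<le> x\<^sup>2 then max 0 (x\<^sup>2 - c * s) else 4/5 * x\<^sup>2)"
    have "4/5 * x\<^sup>2 \<le> max 0 (x\<^sup>2 - c * s)" if "5 * c * s \<le> x\<^sup>2"
      using that by linarith
    then have "x\<^sup>2 - c * s \<le> y0" "4/5 * x\<^sup>2 \<le> y0" by (auto simp: y0_def)
    then have "max 0 (x\<^sup>2 - c * s + (2 * m + u\<^sup>2)) powr q \<le> ?U (x\<^sup>2) s
        + 2 * q * max 0 (x\<^sup>2 - c * s) powr (q - 1) * m + q * c * y0 powr (q - 1) * u\<^sup>2"
      unfolding c_def using q th x0 u False m by (intro truncated_power_jump) auto
    moreover have "x\<^sup>2 + 2 * m + u\<^sup>2 - c * s = x\<^sup>2 - c * s + (2 * m + u\<^sup>2)" by simp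
    moreover have "0 \<le> ?C * u powr (2 * q)" using q by auto
    ultimately show ?thesis unfolding y0_def[symmetric] by (simp only:)
  qed
  have B: "0 \<le> ?B" using q c by simp
  show "?U r s' + ?A r s' * (s' - s) \<le> ?U r s + ?B * (s' powr q - s powr q)"
    if r: "0 \<le> r" and s: "0 \<le> s" "s \<le> s'" for r s s'
  proof (cases "5 * c * s' \<le> r")
    case True
    have cs: "0 \<le> c * s" "c * s \<le> c * s'" using c s by auto
    have "(r - c * s') powr q + q * (r - c * s') powr (q - 1) * ((r - c * s) - (r - c * s'))
        \<le> (r - c * s) powr q"
      using q cs True by (intro powr_tangent) auto
    moreover have "(r - c * s) - (r - c * s') = c * (s' - s)" by (simp add: algebra_simps)
    moreover have "max 0 (r - c * s') = r - c * s'" "max 0 (r - c * s) = r - c * s"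
      using True cs by auto
    moreover have "0 \<le> ?B * (s' powr q - s powr q)"
      using s q by (intro mult_nonneg_nonneg B) (auto intro!: powr_mono2)
    ultimately show ?thesis using True by (simp add: mult_ac)
  next
    case False
    then have "(4/5 * r) powr (q - 1) \<le> ((4 * c) * s') powr (q - 1)"
      using r s q by (intro powr_mono2) auto
    then have "?A r s' * (s' - s) \<le> q * c * ((4 * c) * s') powr (q - 1) * (s' - s)"
      using False s q c by (auto intro!: mult_right_mono mult_left_mono)
    also have "\<dots> = ?B * (s' powr (q - 1) * (s' - s))"
      using s c powr_mult[of "4 * c" s' "q - 1"] by (simp add: mult_ac)
    also have "\<dots> \<le> ?B * (s' powr q - s powr q)"
      using s q B by (intro mult_left_mono diff_powr_ge) auto
    finally have "?A r s' * (s' - s) \<le> ?B * (s' powr q - s powr q)" .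
    moreover have "?U r s' \<le> ?U r s"
    proof (intro powr_mono2)
      have "c * s \<le> c * s'" using s c by simp
      then show "max 0 (r - c * s') \<le> max 0 (r - c * s)" by linarith
    qed (use q in auto)
    ultimately show ?thesis by linarith
  qed
  show "r powr q \<le> (5/4) powr q * ?U r s + (5 * c) powr q * s powr q" if r: "0 \<le> r" and s: "0 \<le> s" for r s
  proof (cases "5 * c * s \<le> r")
    case True
    then have "r powr q \<le> ((5/4) * max 0 (r - c * s)) powr q"
      using r q by (intro powr_mono2) auto
    also have "\<dots> = (5/4) powr q * ?U r s" by (rule powr_mult)
    finally show ?thesis by (simp add: add_increasing2)
  next
    case False
    then have "r powr q \<le> ((5 * c) * s) powr q"
      using r q by (intro powr_mono2) auto
    also have "\<dots> = (5 * c) powr q * s powr q" by (rule powr_mult)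
    finally show ?thesis by (simp add: add_increasing)
  qed
  show "0 \<le> ?A r s" for r s using q c by auto
qed (use q slope_ge_1[OF q, of th] in \<open>auto simp: c_def intro!: mult_nonneg_nonneg\<close>)

section \<open>Comparison with the constant \<open>C_const\<close>\<close>

text \<open>This is \<open>ln x <= x / exp 1\<close> combined with
  \<open>exp 1 >= 8/3\<close>.\<close>

lemma ln_le_three_eighths:
  fixes x :: real
  assumes "0 < x"
  shows "ln x \<le> 3/8 * x"
proof -
  have e: "8/3 \<le> exp (1::real)"
    using e_approx_32 unfolding abs_diff_le_iff by simp
  have "ln (x / exp 1) \<le> x / exp 1 - 1"
    using assms by (intro ln_le_minus_one) auto
  then have "ln x \<le> x / exp 1" using assms by (simp add: ln_div)
  also have "\<dots> \<le> x / (8/3)" using assms e by (intro divide_left_mono) auto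
  finally show ?thesis by simp
qed

lemma C_const_double:
  assumes "0 < q"
  shows "C_const (2 * q) = 8 powr q * (q / 2 + 1) * (1 + 2 * q / ln q) powr (2 * q)"
proof -
  have "2 powr (3 * q) = (2 powr 3) powr q" by (simp only: powr_powr)
  also have "2 powr 3 = (8::real)" by (simp flip: powr_numeral)
  finally show ?thesis by (simp add: C_const_def)
qed

text \<open>
  With this \<open>th\<close> the factor \<open>(1 + 1 / th) powr (2 * q)\<close> produced by the large jumps is
  \<open>(5/2 * W) powr (2 * q)\<close>, which matches \<open>C_const\<close>; the point is that \<open>th\<close> is still small enough for
  \<open>jump_factor th powr (q - 2)\<close> to be at most \<open>sqrt q\<close>.
\<close>
lemma slope_bound:
  fixes q :: real
  assumes q: "2 \<le> q"
  defines "W \<equiv> 1 + 2 * q / ln q"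
  defines "th \<equiv> 1 / (5/2 * W - 1)"
  shows "5 * slope q th \<le> 8 * W\<^sup>2"
proof -
  define L where "L = ln q"
  have L: "0 < L" "L \<le> 3/8 * q" using q ln_le_three_eighths[of q] by (auto simp: L_def)
  have th_eq: "th = L / (5 * q + 3/2 * L)"
    using q L unfolding th_def W_def L_def[symmetric] by (simp add: field_simps)
  have th0: "0 < th" unfolding th_eq using L q by (intro divide_pos_pos) auto
  have thq: "5 * q * th = L - 3/2 * (L * th)"
    unfolding th_eq using L q by (simp add: field_simps)
  then have "5 * q * th \<le> 3/8 * q"
    using L mult_pos_pos[OF L(1) th0] by linarith
  then have th: "th \<le> 3/40" using q by simp
  \<comment> \<open>The quantity equals \<open>2 * q * (jump_factor th - 1)\<close>; bounding it by
    \<open>L = ln q\<close> is what makes \<open>T powr (q - 2)\<close> at most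
    \<open>sqrt q\<close>.\<close>
  have "5 * q * (th * (1 + th / 2)) = (L - 3/2 * (L * th)) * (1 + th / 2)"
    unfolding thq[symmetric] by simp
  also have "\<dots> = L - L * th * (1 + 3/4 * th)" by (simp add: algebra_simps)
  also have "\<dots> \<le> L" using L th0 by simp
  finally have key: "5 * q * (th * (1 + th / 2)) \<le> L" .
  define T where "T = jump_factor th"
  have T: "1 \<le> T" using th0 by (simp add: T_def jump_factor_def)
  have "(q - 2) * ln T \<le> q * (T - 1)"
    using q T ln_le_minus_one[of T] by (intro mult_mono) auto
  also have "\<dots> = (5 * q * (th * (1 + th / 2))) / 2"
    by (simp add: T_def jump_factor_def power2_eq_square algebra_simps)
  also have "\<dots> \<le> L / 2" using key by simp
  finally have "T powr (q - 2) \<le> q powr (1/2)"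
    using T q by (simp add: powr_def L_def)
  then have Tq: "T powr (q - 2) \<le> sqrt q" using q by (simp add: powr_half_sqrt)
  have sq: "1 \<le> sqrt q" using q by simp
  have "5 * slope q th = 5 + 25/8 * (q - 1) * ((2 + th)\<^sup>2 * T powr (q - 2))"
    by (simp add: slope_def T_def)
  also have "\<dots> \<le> 5 + 25/8 * (q - 1) * ((83/40)\<^sup>2 * sqrt q)"
    using q th th0 Tq by (intro add_left_mono mult_left_mono mult_mono power_mono) auto
  also have "\<dots> \<le> 14 * q * sqrt q"
  proof -
    have "25/8 * (q - 1) * ((83/40)\<^sup>2 * sqrt q) = 6889/512 * (q * sqrt q) - 6889/512 * sqrt q"
      by (simp add: power2_eq_square field_simps)
    moreover have "0 \<le> q * sqrt q" using q by simp
    ultimately show ?thesis using sq by linarith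
  qed
  also have "\<dots> \<le> 32 * (q / L)\<^sup>2"
  proof -
    \<comment> \<open>The logarithm bound at the fourth root of \<open>q\<close> gives
      \<open>L\<^sup>2 <= 9/4 * sqrt q\<close>, and \<open>14 * 9/4 = 31.5\<close> is below
      32.\<close>
    define r where "r = sqrt (sqrt q)"
    have r: "1 \<le> r" "q = (r ^ 2) ^ 2" "sqrt q = r ^ 2" using q by (auto simp: r_def)
    have "L = 4 * ln r" unfolding L_def r(2) using r by (simp add: ln_realpow)
    also have "\<dots> \<le> 3/2 * r" using r ln_le_three_eighths[of r] by simp
    finally have "L\<^sup>2 \<le> (3/2 * r)\<^sup>2" using L by (intro power_mono) auto
    also have "\<dots> = 9/4 * r\<^sup>2" by (simp add: power_mult_distrib power_divide)
    finally have "L\<^sup>2 \<le> 9/4 * r\<^sup>2" .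
    then have "14 * L\<^sup>2 \<le> 32 * sqrt q" 
      unfolding r(3) using zero_le_power2[of r] by linarith
    then have "(14 * L\<^sup>2) * (q * sqrt q) \<le> (32 * sqrt q) * (q * sqrt q)"
      using q by (intro mult_right_mono) auto
    also have "\<dots> = 32 * q\<^sup>2" using q by (simp add: power2_eq_square)
    finally show ?thesis using L by (simp add: power_divide field_simps)
  qed
  also have "\<dots> = 8 * (2 * q / L)\<^sup>2" by (simp add: power_divide power_mult_distrib)
  also have "\<dots> \<le> 8 * W\<^sup>2"
    unfolding W_def L_def[symmetric] using L q by (intro mult_left_mono power_mono) auto
  finally show ?thesis .
qed

text \<open>One Bellman function for each range of \<open>q\<close>. The two strict inequalities are
  for the coefficients that the variance term and the sum of the jumps receive in the moment
  bound.\<close>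

lemma bellman_exists:
  fixes q :: real
  assumes q: "1 \<le> q"
  obtains c1 c2 B C k U g A where "bellman q c1 c2 B C k U g A"
    "c1 * B + c2 < C_const (2 * q)" "c1 * C < C_const (2 * q)"
proof -
  define W where "W = 1 + 2 * q / ln q"
  have CW: "C_const (2 * q) = 8 powr q * (q / 2 + 1) * W powr (2 * q)"
    using C_const_double[of q] q by (simp add: W_def)
  consider "q = 1" | "1 < q" "q < 2" | "2 \<le> q" using q by linarith
  then show thesis
  proof cases
    case 1
    \<comment> \<open>\<open>ln 1 = 0\<close> and division by zero is 0, so \<open>W = 1\<close> and
      the value is \<open>8 * 3/2\<close>.\<close>
    then have "C_const (2 * q) = 12" unfolding CW by (simp add: W_def)
    with 1 bellman_square show thesis
      by (intro that[of 1 0 1 0 2 "\<lambda>r _. r" "\<lambda>_ _. 2" "\<lambda>_ _. 1"]) auto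
  next
    case 2
    \<comment> \<open>From \<open>ln q <= 3/8 * q\<close> the quotient is at least
      \<open>16/3\<close>. Hence \<open>W >= 6\<close>, and the base 288 below is
      \<open>8 * 36\<close>.\<close>
    have "2 * q / ln q \<ge> 5"
      using 2 ln_le_three_eighths[of q] by (simp add: field_simps)
    then have W: "6 \<le> W" by (simp add: W_def)
    have "36 powr q = 6 powr (2 * q)" using power2_powr[of 6 q] by simp
    also have "\<dots> \<le> W powr (2 * q)" using W q by (intro powr_mono2) auto
    finally have W36: "36 powr q \<le> W powr (2 * q)" .
    have "8 powr q * (3/2) * 36 powr q \<le> C_const (2 * q)"
      unfolding CW using q W36 by (intro mult_mono) auto
    also have "8 powr q * (3/2) * 36 powr q = 3/2 * 288 powr q"
      using powr_mult[of 8 36 q] by simp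
    finally have C: "3/2 * 288 powr q \<le> C_const (2 * q)" .
    \<comment> \<open>Since \<open>b <= b powr q\<close>, only the product \<open>a * b\<close>
      matters: \<open>66 * 4 = 264\<close> and \<open>25 * 8 = 200\<close> lie below 288.\<close>
    have *: "b * a powr q < 288 powr q" if "0 < a" "1 \<le> b" "a * b < 288" for a b :: real
    proof -
      have "b powr 1 \<le> b powr q" using that q by (intro powr_mono) auto
      then have "b * a powr q \<le> b powr q * a powr q"
        using that by (intro mult_right_mono) auto
      also have "\<dots> = (a * b) powr q" using that by (simp add: powr_mult)
      also have "\<dots> < 288 powr q" using that q by (intro powr_less_mono2) auto
      finally show ?thesis .
    qed
    show thesis
    proof (rule that[OF bellman_truncated_square])
      have s: "4 * 66 powr q < (288::real) powr q" by (rule *) auto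
      have "4 * (33 * 66 powr (q - 1)) + 66 powr q = 3 * 66 powr q"
        by (simp add: powr_diff)
      then show "4 * (33 * 66 powr (q - 1)) + 66 powr q < C_const (2 * q)"
        using C s powr_ge_zero[of 288 q] by linarith
      have s: "8 * 25 powr q < (288::real) powr q" by (rule *) auto
      have "4 * (25 powr q + 16 powr q) \<le> 4 * (25 powr q + 25 powr q)"
        using q by (intro mult_left_mono add_left_mono powr_mono2) auto
      also have "\<dots> = 8 * 25 powr q" by simp
      also have "\<dots> < 288 powr q" by (rule s)
      also have "\<dots> \<le> C_const (2 * q)" using C powr_ge_zero[of 288 q] by linarith
      finally show "4 * (25 powr q + 16 powr q) < C_const (2 * q)" .
    qed (use 2 in auto)
  next
    case 3
    \<comment> \<open>Chosen so that \<open>1 + 1 / th = 5/2 * W\<close>. The large jumps then cost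
      a multiple of \<open>(25/4) powr q * W powr (2 * q)\<close>, and the factor
      \<open>c1 = (5/4) powr q\<close> raises the base to \<open>125/16\<close>, still below
      8.\<close>
    define th where "th = 1 / (5/2 * W - 1)"
    define c where "c = slope q th"
    have "0 < ln q" using 3 by simp
    then have W: "1 < W" using 3 by (simp add: W_def)
    then have th: "0 < th" "1 + 1 / th = 5/2 * W" by (auto simp: th_def)
    have c1: "1 \<le> c" unfolding c_def using 3 by (rule slope_ge_1)
    have c: "5 * c \<le> 8 * W\<^sup>2"
      unfolding c_def th_def W_def using 3 by (rule slope_bound)
    have W8: "(8 * W\<^sup>2) powr q = 8 powr q * W powr (2 * q)"
      using W by (simp add: powr_mult power2_powr)
    show thesis
    proof (rule that[OF bellman_truncated_power[OF 3 th(1)]])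
      have "q * c * (4 * c) powr (q - 1) = q / 4 * (4 * c) powr q"
        using c1 by (simp add: powr_diff)
      then have "(5/4) powr q * (q * c * (4 * c) powr (q - 1)) = q / 4 * ((5/4) powr q * (4 * c) powr q)"
        by simp
      also have "(5/4) powr q * (4 * c) powr q = (5 * c) powr q"
        using c1 powr_mult[of "5/4" "4 * c" q] by simp
      finally have "(5/4) powr q * (q * c * (4 * c) powr (q - 1)) + (5 * c) powr q
          = (q / 4 + 1) * (5 * c) powr q" by (simp add: algebra_simps)
      also have "\<dots> \<le> (q / 4 + 1) * (8 * W\<^sup>2) powr q"
        using 3 c c1 by (intro mult_left_mono powr_mono2) auto
      also have "\<dots> < (q / 2 + 1) * (8 * W\<^sup>2) powr q"
        using 3 W by (intro mult_strict_right_mono) auto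
      also have "\<dots> = C_const (2 * q)" unfolding CW W8 by simp
      finally show "(5/4) powr q * (q * slope q th * (4 * slope q th) powr (q - 1)) + (5 * slope q th) powr q
          < C_const (2 * q)" unfolding c_def .
      \<comment> \<open>Bernoulli's inequality shows that the second summand of \<open>C\<close> is
        at most the first; the resulting factor 2 is covered by \<open>q / 2 + 1\<close>.\<close>
      have "1 powr (2 * q) + 2 * q * 1 powr (2 * q - 1) * ((1 + th) - 1) \<le> (1 + th) powr (2 * q)"
        using 3 th by (intro powr_tangent) auto
      then have "2 * q * th \<le> (1 + th) powr (2 * q)" by simp
      then have "(1 / th) powr (2 * q) * (2 * q * th) \<le> (1 / th) powr (2 * q) * (1 + th) powr (2 * q)"
        by (intro mult_left_mono) auto
      also have "\<dots> = (1 + 1 / th) powr (2 * q)"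
        using th(1) by (simp add: powr_mult[symmetric] field_simps)
      also have "(1 / th) powr (2 * q) * (2 * q * th) = 2 * q * th powr (1 - 2 * q)"
        using th(1) by (simp add: powr_diff powr_divide)
      finally have "(5/4) powr q * ((1 + 1 / th) powr (2 * q) + 2 * q * th powr (1 - 2 * q))
          \<le> (5/4) powr q * (2 * (5/2 * W) powr (2 * q))"
        unfolding th(2) by (intro mult_left_mono) auto
      also have "(5/2 * W) powr (2 * q) = (25/4) powr q * W powr (2 * q)"
        using power2_powr[of "5/2" q] powr_mult[of "5/2" W "2 * q"] by (simp add: power_divide)
      also have "(5/4) powr q * (2 * ((25/4) powr q * W powr (2 * q)))
          = 2 * ((5/4) powr q * (25/4) powr q) * W powr (2 * q)" by simp
      also have "(5/4) powr q * (25/4) powr q = (125/16::real) powr q"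
        using powr_mult[of "5/4" "25/4" q] by simp
      also have "2 * (125/16) powr q * W powr (2 * q) < (q / 2 + 1) * 8 powr q * W powr (2 * q)"
        using 3 W by (intro mult_strict_right_mono mult_le_less_imp_less powr_less_mono2) auto
      also have "\<dots> = C_const (2 * q)" unfolding CW by simp
      finally show "(5/4) powr q * ((1 + 1 / th) powr (2 * q) + 2 * q * th powr (1 - 2 * q))
          < C_const (2 * q)" .
    qed
  qed
qed

subsection \<open>The Burkholder--Rosenthal inequality\<close>

lemma mult_powr_le_add_powr:
  fixes a b r s :: real
  assumes "0 \<le> a" "0 \<le> b" "0 \<le> r" "0 \<le> s"
  shows "a powr r * b powr s \<le> a powr (r + s) + b powr (r + s)"
proof -
  have "a powr r * b powr s \<le> max a b powr r * max a b powr s"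
    using assms by (intro mult_mono powr_mono2) auto
  also have "\<dots> = max a b powr (r + s)" by (simp add: powr_add)
  also have "\<dots> \<le> a powr (r + s) + b powr (r + s)" by (simp add: max_def)
  finally show ?thesis .
qed

lemma square_le_one_add_powr:
  fixes x p :: real
  assumes "2 \<le> p" "0 \<le> x"
  shows "x\<^sup>2 \<le> 1 + x powr p"
proof (cases "x \<le> 1")
  case True
  then show ?thesis using assms by (auto simp: power_le_one intro: add_increasing2)
next
  case False
  then have "x powr 2 \<le> x powr p" using assms by (intro powr_mono) auto
  then show ?thesis using False by simp
qed

text \<open>Vanishing integrals over the sets of \<open>G\<close> say that \<open>d\<close> has
  conditional mean 0. For simple \<open>Y\<close> the claim is a finite sum of such integrals over
  level sets; a general \<open>Y\<close> is a limit of simple functions of norm at most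
  \<open>2 * norm Y\<close>, which supplies the dominating function.\<close>

lemma integral_inner_eq_0:
  fixes Y d :: "'a \<Rightarrow> 'h::{real_inner, banach, second_countable_topology}"
  assumes sub: "subalgebra M G" and Y: "Y \<in> borel_measurable G" and d: "integrable M d"
    and zero: "\<And>A. A \<in> sets G \<Longrightarrow> set_lebesgue_integral M A d = 0"
    and int: "integrable M (\<lambda>\<omega>. norm (Y \<omega>) * norm (d \<omega>))"
  shows "integrable M (\<lambda>\<omega>. Y \<omega> \<bullet> d \<omega>)" "(\<integral>\<omega>. Y \<omega> \<bullet> d \<omega> \<partial>M) = 0"
proof -
  have sp: "space G = space M" using sub by (simp add: subalgebra_def)
  have GM: "A \<in> sets G \<Longrightarrow> A \<in> sets M" for A using sub by (auto simp: subalgebra_def)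
  have [measurable]: "Y \<in> borel_measurable M" using measurable_from_subalg[OF sub Y] .
  have [measurable]: "d \<in> borel_measurable M" using d by simp
  show "integrable M (\<lambda>\<omega>. Y \<omega> \<bullet> d \<omega>)"
    by (rule Bochner_Integration.integrable_bound[OF int]) (auto intro!: AE_I2 Cauchy_Schwarz_ineq2)
  obtain S where S: "\<And>i. simple_function G (S i)"
      "\<And>\<omega>. \<omega> \<in> space G \<Longrightarrow> (\<lambda>i. S i \<omega>) \<longlonglongrightarrow> Y \<omega>"
      "\<And>i \<omega>. \<omega> \<in> space G \<Longrightarrow> dist (S i \<omega>) 0 \<le> 2 * dist (Y \<omega>) 0"
    using borel_measurable_implies_sequence_metric[OF Y, of 0] by blast
  have [measurable]: "S i \<in> borel_measurable M" for i
    using measurable_from_subalg[OF sub borel_measurable_simple_function[OF S(1)]] .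
  have S0: "(\<integral>\<omega>. S i \<omega> \<bullet> d \<omega> \<partial>M) = 0" for i
  proof -
    define I where "I = S i ` space G"
    define E where "E y = S i -` {y} \<inter> space G" for y
    have fin: "finite I" and E: "\<And>y. E y \<in> sets G"
      using simple_functionD[OF S(1), of i] by (auto simp: I_def E_def)
    have "S i \<omega> \<bullet> d \<omega> = (\<Sum>y\<in>I. y \<bullet> (indicator (E y) \<omega> *\<^sub>R d \<omega>))" if "\<omega> \<in> space M" for \<omega>
    proof -
      have "(\<Sum>y\<in>I. y \<bullet> (indicator (E y) \<omega> *\<^sub>R d \<omega>)) = (\<Sum>y\<in>I. if y = S i \<omega> then y \<bullet> d \<omega> else 0)"
        using that by (intro sum.cong) (auto simp: E_def sp indicator_def)
      also have "\<dots> = S i \<omega> \<bullet> d \<omega>"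
        using fin that by (simp add: I_def sp)
      finally show ?thesis by simp
    qed
    then have "(\<integral>\<omega>. S i \<omega> \<bullet> d \<omega> \<partial>M) = (\<integral>\<omega>. (\<Sum>y\<in>I. y \<bullet> (indicator (E y) \<omega> *\<^sub>R d \<omega>)) \<partial>M)"
      by (intro Bochner_Integration.integral_cong) auto
    also have "\<dots> = (\<Sum>y\<in>I. \<integral>\<omega>. y \<bullet> (indicator (E y) \<omega> *\<^sub>R d \<omega>) \<partial>M)"
      using d GM[OF E] by (intro Bochner_Integration.integral_sum integrable_inner_right integrable_mult_indicator) auto
    also have "\<dots> = (\<Sum>y\<in>I. y \<bullet> set_lebesgue_integral M (E y) d)"
      unfolding set_lebesgue_integral_def
      using d GM[OF E] by (intro sum.cong refl integral_inner_right integrable_mult_indicator) auto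
    also have "\<dots> = 0" using zero[OF E] by simp
    finally show ?thesis .
  qed
  have "(\<lambda>i. \<integral>\<omega>. S i \<omega> \<bullet> d \<omega> \<partial>M) \<longlonglongrightarrow> (\<integral>\<omega>. Y \<omega> \<bullet> d \<omega> \<partial>M)"
  proof (rule integral_dominated_convergence[where w = "\<lambda>\<omega>. 2 * (norm (Y \<omega>) * norm (d \<omega>))"])
    show "AE \<omega> in M. (\<lambda>i. S i \<omega> \<bullet> d \<omega>) \<longlonglongrightarrow> Y \<omega> \<bullet> d \<omega>"
      using S(2) by (intro AE_I2 tendsto_intros) (auto simp: sp)
    show "AE \<omega> in M. norm (S i \<omega> \<bullet> d \<omega>) \<le> 2 * (norm (Y \<omega>) * norm (d \<omega>))" for i
    proof (intro AE_I2)
      fix \<omega> assume "\<omega> \<in> space M"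
      then have "norm (S i \<omega>) \<le> 2 * norm (Y \<omega>)" using S(3)[of \<omega> i] by (simp add: sp)
      then have "norm (S i \<omega>) * norm (d \<omega>) \<le> 2 * norm (Y \<omega>) * norm (d \<omega>)"
        by (intro mult_right_mono) auto
      then show "norm (S i \<omega> \<bullet> d \<omega>) \<le> 2 * (norm (Y \<omega>) * norm (d \<omega>))"
        using Cauchy_Schwarz_ineq2[of "S i \<omega>" "d \<omega>"] by simp
    qed
  qed (use int in auto)
  then show "(\<integral>\<omega>. Y \<omega> \<bullet> d \<omega> \<partial>M) = 0"
    unfolding S0 by (simp add: LIMSEQ_const_iff)
qed

text \<open>\<open>jump\<close> is applied pointwise at the new variance \<open>t = s + v\<close>
  and integrated. The linear term vanishes and the quadratic one becomes the integral of
  \<open>A' * v\<close>, because \<open>g'\<close>, \<open>x\<close> and \<open>A'\<close> are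
  \<open>G\<close>-measurable; then \<open>compensate\<close> returns from \<open>t\<close> to
  \<open>s\<close>.\<close>

lemma (in bellman) one_step:
  fixes x d :: "'a \<Rightarrow> 'h::{real_inner, banach, second_countable_topology}" and s v :: "'a \<Rightarrow> real"
  assumes M: "prob_space M" and sub: "subalgebra M G"
    and x: "x \<in> borel_measurable G" and s: "s \<in> borel_measurable G" "\<And>\<omega>. 0 \<le> s \<omega>"
    and v: "v \<in> borel_measurable G" "\<And>\<omega>. 0 \<le> v \<omega>"
    and d: "integrable M d" "\<And>D. D \<in> sets G \<Longrightarrow> set_lebesgue_integral M D d = 0"
    and xp: "integrable M (\<lambda>\<omega>. norm (x \<omega>) powr (2 * q))"
    and dp: "integrable M (\<lambda>\<omega>. norm (d \<omega>) powr (2 * q))"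
    and sp: "integrable M (\<lambda>\<omega>. s \<omega> powr q)" "integrable M (\<lambda>\<omega>. (s \<omega> + v \<omega>) powr q)"
    and cond: "AE \<omega> in M. nn_cond_exp M G (\<lambda>\<omega>. ennreal ((norm (d \<omega>))\<^sup>2)) \<omega> = ennreal (v \<omega>)"
  shows "(\<integral>\<omega>. U ((norm (x \<omega> + d \<omega>))\<^sup>2) (s \<omega> + v \<omega>) \<partial>M)
     \<le> (\<integral>\<omega>. U ((norm (x \<omega>))\<^sup>2) (s \<omega>) \<partial>M)
       + B * ((\<integral>\<omega>. (s \<omega> + v \<omega>) powr q \<partial>M) - (\<integral>\<omega>. s \<omega> powr q \<partial>M))
       + C * (\<integral>\<omega>. norm (d \<omega>) powr (2 * q) \<partial>M)"
proof -
  interpret prob_space M by (rule M)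
  interpret finite_measure_subalgebra M G by unfold_locales (rule sub)
  note [measurable] = measurable_from_subalg[OF sub x] measurable_from_subalg[OF sub s(1)]
    measurable_from_subalg[OF sub v(1)]
  have [measurable]: "d \<in> borel_measurable M" using d by simp
  have comp: "(\<lambda>\<omega>. h (f1 \<omega>) (f2 \<omega>)) \<in> borel_measurable N"
    if "case_prod h \<in> borel_measurable (borel \<Otimes>\<^sub>M borel)" "f1 \<in> borel_measurable N" "f2 \<in> borel_measurable N"
    for h :: "real \<Rightarrow> real \<Rightarrow> real" and f1 f2 and N :: "'a measure"
    using measurable_compose[OF measurable_Pair[OF that(2,3)] that(1)] by simp
  define t where "t \<omega> = s \<omega> + v \<omega>" for \<omega>
  have t0: "0 \<le> t \<omega>" for \<omega> using s(2) v(2) by (simp add: t_def)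
  have tG: "t \<in> borel_measurable G" unfolding t_def using s v by measurable
  have [measurable]: "t \<in> borel_measurable M" using measurable_from_subalg[OF sub tG] .
  have n2G: "(\<lambda>\<omega>. (norm (x \<omega>))\<^sup>2) \<in> borel_measurable G" using x by measurable
  define g' where "g' \<omega> = g ((norm (x \<omega>))\<^sup>2) (t \<omega>)" for \<omega>
  define A' where "A' \<omega> = A ((norm (x \<omega>))\<^sup>2) (t \<omega>)" for \<omega>
  have gG: "g' \<in> borel_measurable G" unfolding g'_def by (rule comp[OF measurable_g n2G tG])
  have AG: "A' \<in> borel_measurable G" unfolding A'_def by (rule comp[OF measurable_A n2G tG])
  have [measurable]: "g' \<in> borel_measurable M" "A' \<in> borel_measurable M"
    using measurable_from_subalg[OF sub] gG AG by blast+
  have A0: "0 \<le> A' \<omega>" for \<omega> unfolding A'_def using t0 by (intro A_nonneg) auto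
  have xdp: "integrable M (\<lambda>\<omega>. norm (x \<omega>) powr (2 * q) + norm (d \<omega>) powr (2 * q))"
    using xp dp by simp
  have Y: "(\<lambda>\<omega>. g' \<omega> *\<^sub>R x \<omega>) \<in> borel_measurable G" using gG x by measurable
  \<comment> \<open>The exponents \<open>2 * q - 1\<close> and 1 add up to \<open>2 * q\<close>, so
    moments of that order make the linear term integrable.\<close>
  have gb: "norm (g' \<omega> *\<^sub>R x \<omega>) * norm (d \<omega>)
      \<le> k * (norm (x \<omega>) powr (2 * q) + norm (d \<omega>) powr (2 * q))" for \<omega>
  proof -
    have "norm (g' \<omega> *\<^sub>R x \<omega>) * norm (d \<omega>) \<le> (k * norm (x \<omega>) powr (2 * q - 1)) * norm (d \<omega>)"
      unfolding g'_def norm_scaleR real_norm_def using t0 by (intro mult_right_mono g_bound) auto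
    also have "\<dots> = k * (norm (x \<omega>) powr (2 * q - 1) * norm (d \<omega>) powr 1)" by simp
    also have "\<dots> \<le> k * (norm (x \<omega>) powr (2 * q - 1 + 1) + norm (d \<omega>) powr (2 * q - 1 + 1))"
      using q nonneg by (intro mult_left_mono mult_powr_le_add_powr) auto
    finally show ?thesis by simp
  qed
  have Yint: "integrable M (\<lambda>\<omega>. norm (g' \<omega> *\<^sub>R x \<omega>) * norm (d \<omega>))"
    by (rule Bochner_Integration.integrable_bound[OF integrable_mult_right[OF xdp, of k]])
       (use gb nonneg in \<open>auto intro!: AE_I2\<close>)
  note lin = integral_inner_eq_0[OF sub Y d Yint]
  have d2: "(norm (d \<omega>))\<^sup>2 \<le> 1 + norm (d \<omega>) powr (2 * q)" for \<omega>
    using q by (intro square_le_one_add_powr) auto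
  have Ab: "A' \<omega> * (norm (d \<omega>))\<^sup>2 \<le> k * (1 + norm (d \<omega>) powr (2 * q)
      + (norm (x \<omega>) powr (2 * q) + norm (d \<omega>) powr (2 * q)))" for \<omega>
  proof -
    have "A' \<omega> * (norm (d \<omega>))\<^sup>2 \<le> (k * (1 + norm (x \<omega>) powr (2 * q - 2))) * (norm (d \<omega>))\<^sup>2"
      unfolding A'_def using t0 by (intro mult_right_mono A_bound) auto
    also have "\<dots> = k * ((norm (d \<omega>))\<^sup>2 + norm (x \<omega>) powr (2 * q - 2) * norm (d \<omega>) powr 2)"
      by (simp add: algebra_simps)
    also have "\<dots> \<le> k * ((1 + norm (d \<omega>) powr (2 * q))
        + (norm (x \<omega>) powr (2 * q - 2 + 2) + norm (d \<omega>) powr (2 * q - 2 + 2)))"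
      using q nonneg d2 by (intro mult_left_mono add_mono mult_powr_le_add_powr) auto
    finally show ?thesis by (simp add: algebra_simps)
  qed
  have Aint: "integrable M (\<lambda>\<omega>. A' \<omega> * (norm (d \<omega>))\<^sup>2)"
  proof (rule Bochner_Integration.integrable_bound)
    show "integrable M (\<lambda>\<omega>. k * (1 + norm (d \<omega>) powr (2 * q)
      + (norm (x \<omega>) powr (2 * q) + norm (d \<omega>) powr (2 * q))))"
      using xp dp by (intro integrable_mult_right Bochner_Integration.integrable_add) auto
  qed (use Ab A0 in \<open>auto intro!: AE_I2 order_trans[OF _ abs_ge_self]\<close>)
  \<comment> \<open>The identity is taken in the extended nonnegative reals, so that integrability
    of \<open>A' * v\<close> can be deduced from it.\<close>
  have nnA: "(\<integral>\<^sup>+\<omega>. ennreal (A' \<omega> * v \<omega>) \<partial>M) = (\<integral>\<^sup>+\<omega>. ennreal (A' \<omega> * (norm (d \<omega>))\<^sup>2) \<partial>M)"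
  proof -
    have "(\<integral>\<^sup>+\<omega>. ennreal (A' \<omega> * v \<omega>) \<partial>M)
        = (\<integral>\<^sup>+\<omega>. ennreal (A' \<omega>) * nn_cond_exp M G (\<lambda>\<omega>. ennreal ((norm (d \<omega>))\<^sup>2)) \<omega> \<partial>M)"
      using cond A0 v(2) by (intro nn_integral_cong_AE) (auto elim!: eventually_mono simp: ennreal_mult)
    also have "\<dots> = (\<integral>\<^sup>+\<omega>. ennreal (A' \<omega>) * ennreal ((norm (d \<omega>))\<^sup>2) \<partial>M)"
      using AG by (intro nn_cond_exp_intg) auto
    also have "\<dots> = (\<integral>\<^sup>+\<omega>. ennreal (A' \<omega> * (norm (d \<omega>))\<^sup>2) \<partial>M)"
      using A0 by (simp add: ennreal_mult)
    finally show ?thesis .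
  qed
  have Avint: "integrable M (\<lambda>\<omega>. A' \<omega> * v \<omega>)"
  proof (rule integrableI_bounded)
    have "(\<integral>\<^sup>+\<omega>. ennreal (norm (A' \<omega> * v \<omega>)) \<partial>M) = (\<integral>\<^sup>+\<omega>. ennreal (norm (A' \<omega> * (norm (d \<omega>))\<^sup>2)) \<partial>M)"
      using nnA A0 v(2) by simp
    also have "\<dots> < \<infinity>" using Aint unfolding integrable_iff_bounded by blast
    finally show "(\<integral>\<^sup>+\<omega>. ennreal (norm (A' \<omega> * v \<omega>)) \<partial>M) < \<infinity>" .
  qed measurable
  have Aeq: "(\<integral>\<omega>. A' \<omega> * (norm (d \<omega>))\<^sup>2 \<partial>M) = (\<integral>\<omega>. A' \<omega> * v \<omega> \<partial>M)"
    using nnA A0 v(2) by (simp add: integral_eq_nn_integral)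
  have Uint: "integrable M (\<lambda>\<omega>. U ((norm (x \<omega>))\<^sup>2) (f \<omega>))"
    if f: "f \<in> borel_measurable M" "\<And>\<omega>. 0 \<le> f \<omega>" for f
  proof (rule Bochner_Integration.integrable_bound[OF xp])
    show "(\<lambda>\<omega>. U ((norm (x \<omega>))\<^sup>2) (f \<omega>)) \<in> borel_measurable M"
      by (rule comp[OF measurable_U _ f(1)]) measurable
    show "AE \<omega> in M. norm (U ((norm (x \<omega>))\<^sup>2) (f \<omega>)) \<le> norm (norm (x \<omega>) powr (2 * q))"
      using U_nonneg U_le f by (auto intro!: AE_I2 simp flip: power2_powr)
  qed
  have Ut: "integrable M (\<lambda>\<omega>. U ((norm (x \<omega>))\<^sup>2) (t \<omega>))" by (intro Uint t0) measurable
  have Us: "integrable M (\<lambda>\<omega>. U ((norm (x \<omega>))\<^sup>2) (s \<omega>))" by (intro Uint s(2)) measurable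
  have "(\<integral>\<omega>. U ((norm (x \<omega> + d \<omega>))\<^sup>2) (t \<omega>) \<partial>M)
      \<le> (\<integral>\<omega>. U ((norm (x \<omega>))\<^sup>2) (t \<omega>) + (g' \<omega> *\<^sub>R x \<omega>) \<bullet> d \<omega> + A' \<omega> * (norm (d \<omega>))\<^sup>2
              + C * norm (d \<omega>) powr (2 * q) \<partial>M)"
  proof (rule Bochner_Integration.integral_mono')
    show "integrable M (\<lambda>\<omega>. U ((norm (x \<omega>))\<^sup>2) (t \<omega>) + (g' \<omega> *\<^sub>R x \<omega>) \<bullet> d \<omega> + A' \<omega> * (norm (d \<omega>))\<^sup>2
              + C * norm (d \<omega>) powr (2 * q))"
      using Ut lin(1) Aint dp by simp
    fix \<omega>
    have "U ((norm (x \<omega>))\<^sup>2 + 2 * (x \<omega> \<bullet> d \<omega>) + (norm (d \<omega>))\<^sup>2) (t \<omega>)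
        \<le> U ((norm (x \<omega>))\<^sup>2) (t \<omega>) + g ((norm (x \<omega>))\<^sup>2) (t \<omega>) * (x \<omega> \<bullet> d \<omega>)
          + A ((norm (x \<omega>))\<^sup>2) (t \<omega>) * (norm (d \<omega>))\<^sup>2 + C * norm (d \<omega>) powr (2 * q)"
      using t0 by (intro jump Cauchy_Schwarz_ineq2) auto
    moreover have "(norm (x \<omega> + d \<omega>))\<^sup>2 = (norm (x \<omega>))\<^sup>2 + 2 * (x \<omega> \<bullet> d \<omega>) + (norm (d \<omega>))\<^sup>2"
      by (simp add: power2_norm_eq_inner inner_add_left inner_add_right inner_commute)
    ultimately show le: "U ((norm (x \<omega> + d \<omega>))\<^sup>2) (t \<omega>) \<le> U ((norm (x \<omega>))\<^sup>2) (t \<omega>) + (g' \<omega> *\<^sub>R x \<omega>) \<bullet> d \<omega>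
          + A' \<omega> * (norm (d \<omega>))\<^sup>2 + C * norm (d \<omega>) powr (2 * q)"
      by (simp add: g'_def A'_def)
    have "0 \<le> U ((norm (x \<omega> + d \<omega>))\<^sup>2) (t \<omega>)" using t0 by (intro U_nonneg) auto
    then show "0 \<le> U ((norm (x \<omega>))\<^sup>2) (t \<omega>) + (g' \<omega> *\<^sub>R x \<omega>) \<bullet> d \<omega>
          + A' \<omega> * (norm (d \<omega>))\<^sup>2 + C * norm (d \<omega>) powr (2 * q)" using le by (rule order_trans)
  qed
  also have "\<dots> = (\<integral>\<omega>. U ((norm (x \<omega>))\<^sup>2) (t \<omega>) \<partial>M) + (\<integral>\<omega>. A' \<omega> * v \<omega> \<partial>M)
      + C * (\<integral>\<omega>. norm (d \<omega>) powr (2 * q) \<partial>M)"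
    using Ut lin Aint dp by (simp add: Aeq)
  also have "(\<integral>\<omega>. U ((norm (x \<omega>))\<^sup>2) (t \<omega>) \<partial>M) + (\<integral>\<omega>. A' \<omega> * v \<omega> \<partial>M)
      = (\<integral>\<omega>. U ((norm (x \<omega>))\<^sup>2) (t \<omega>) + A' \<omega> * v \<omega> \<partial>M)"
    using Ut Avint by simp
  also have "\<dots> \<le> (\<integral>\<omega>. U ((norm (x \<omega>))\<^sup>2) (s \<omega>) + B * (t \<omega> powr q - s \<omega> powr q) \<partial>M)"
  proof (rule integral_mono)
    show "integrable M (\<lambda>\<omega>. U ((norm (x \<omega>))\<^sup>2) (s \<omega>) + B * (t \<omega> powr q - s \<omega> powr q))"
      using Us sp unfolding t_def by simp
    show "U ((norm (x \<omega>))\<^sup>2) (t \<omega>) + A' \<omega> * v \<omega>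
        \<le> U ((norm (x \<omega>))\<^sup>2) (s \<omega>) + B * (t \<omega> powr q - s \<omega> powr q)" for \<omega>
      using compensate[of "(norm (x \<omega>))\<^sup>2" "s \<omega>" "t \<omega>"] s(2) v(2) by (simp add: A'_def t_def)
  qed (use Ut Avint in auto)
  also have "\<dots> = (\<integral>\<omega>. U ((norm (x \<omega>))\<^sup>2) (s \<omega>) \<partial>M)
      + B * ((\<integral>\<omega>. t \<omega> powr q \<partial>M) - (\<integral>\<omega>. s \<omega> powr q \<partial>M))"
    using Us sp unfolding t_def by simp
  finally show ?thesis unfolding t_def by simp
qed


lemma powr_add_le:
  fixes a b p :: real
  assumes "0 \<le> p" "0 \<le> a" "0 \<le> b"
  shows "(a + b) powr p \<le> 2 powr p * (a powr p + b powr p)"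
proof -
  have "(a + b) powr p \<le> (2 * max a b) powr p"
    using assms by (intro powr_mono2) auto
  also have "\<dots> = 2 powr p * max a b powr p" by (rule powr_mult)
  also have "\<dots> \<le> 2 powr p * (a powr p + b powr p)"
    by (intro mult_left_mono) (auto simp: max_def)
  finally show ?thesis .
qed

text \<open>If the right side is infinite there is nothing to show; otherwise its finiteness
  supplies all integrability. Then \<open>one_step\<close> is iterated along \<open>X\<close> and
  \<open>S\<close>, the \<open>B\<close> terms telescope, and \<open>majorant\<close> converts the
  bound on \<open>U\<close> into one on the moment.\<close>

lemma (in bellman) rosenthal:
  fixes X :: "nat \<Rightarrow> 'a \<Rightarrow> 'h::{real_inner, banach, second_countable_topology}"
  assumes M: "prob_space M" and mart: "martingale M F X" and X0: "AE \<omega> in M. X 0 \<omega> = 0"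
    and K: "0 < K" "c1 * B + c2 \<le> K" "c1 * C \<le> K"
  shows "(\<integral>\<^sup>+\<omega>. ennreal (norm (X n \<omega>) powr (2 * q)) \<partial>M)
    \<le> ennreal K * (\<integral>\<^sup>+ \<omega>. (\<Sum>j=1..n. ennreal (norm (incr X j \<omega>) powr (2 * q))) +
            epowr (\<Sum>j=1..n. nn_cond_exp M (F (j - 1)) (\<lambda>\<omega>'. ennreal ((norm (incr X j \<omega>'))\<^sup>2)) \<omega>) q \<partial>M)"
    (is "_ \<le> _ * ?D")
proof (cases "?D = \<infinity>")
  case True
  then show ?thesis using K by (simp add: ennreal_mult_top)
next
  case False
  interpret prob_space M by (rule M)
  have filt: "filtration (space M) F" and sub: "subalgebra M (F i)"
    and adapted: "X i \<in> borel_measurable (F i)" and Xint: "integrable M (X i)"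
    and mce: "i \<le> j \<Longrightarrow> has_cond_exp M (F i) (X j) (X i)" for i j
    using mart by (auto simp: martingale_def)
  define p where "p = 2 * q"
  have p: "2 \<le> p" using q by (simp add: p_def)
  define d where "d j = incr X j" for j
  have dS: "d (Suc j) \<omega> = X (Suc j) \<omega> - X j \<omega>" for j \<omega> by (simp add: d_def incr_def)
  define w where "w j = nn_cond_exp M (F (j - 1)) (\<lambda>\<omega>. ennreal ((norm (d j \<omega>))\<^sup>2))" for j
  have Fmono: "Y \<in> borel_measurable (F j)" if "Y \<in> borel_measurable (F i)" "i \<le> j"
    for Y :: "'a \<Rightarrow> ennreal" and i j
  proof -
    have "subalgebra (F j) (F i)"
      using filt that(2) by (simp add: subalgebra_def filtration.space_F filtration.sets_F_mono)
    then show ?thesis using that(1) by (rule measurable_from_subalg)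
  qed
  have [measurable]: "X i \<in> borel_measurable M" for i
    using measurable_from_subalg[OF sub adapted] .
  have [measurable]: "d i \<in> borel_measurable M" for i
    unfolding d_def incr_def by measurable
  have [measurable]: "w i \<in> borel_measurable M" for i unfolding w_def by measurable
  \<comment> \<open>\<open>enn2real\<close> sends infinity to 0; by \<open>w_fin\<close> the
    conditional variances up to time \<open>n\<close> are almost surely finite, so nothing is
    lost.\<close>
  define S where "S j \<omega> = (\<Sum>i=1..j. enn2real (w i \<omega>))" for j \<omega>
  have S0: "0 \<le> S j \<omega>" for j \<omega> by (simp add: S_def sum_nonneg)
  have S_Suc: "S (Suc j) \<omega> = S j \<omega> + enn2real (w (Suc j) \<omega>)" for j \<omega> by (simp add: S_def)
  have w_pred: "w i \<in> borel_measurable (F j)" if "i \<le> Suc j" for i j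
    unfolding w_def by (rule Fmono[OF borel_measurable_nn_cond_exp]) (use that in simp)
  \<comment> \<open>Predictability: \<open>w i\<close> is measurable for \<open>F (i - 1)\<close>,
    which allows \<open>i = Suc j\<close>, as \<open>one_step\<close> requires.\<close>
  have S_pred: "S i \<in> borel_measurable (F j)" if "i \<le> Suc j" for i j
  proof -
    have [measurable]: "w l \<in> borel_measurable (F j)" if "l \<in> {1..i}" for l
      by (rule w_pred) (use that \<open>i \<le> Suc j\<close> in simp)
    show ?thesis unfolding S_def by measurable
  qed
  have [measurable]: "S i \<in> borel_measurable M" for i unfolding S_def by measurable
  have D_eq: "?D = (\<Sum>j=1..n. \<integral>\<^sup>+\<omega>. ennreal (norm (d j \<omega>) powr p) \<partial>M)
      + (\<integral>\<^sup>+\<omega>. epowr (\<Sum>j=1..n. w j \<omega>) q \<partial>M)"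
  proof -
    have [measurable]: "(\<lambda>y. epowr y q) \<in> borel_measurable borel"
      unfolding epowr_def by measurable
    show ?thesis
      unfolding w_def[symmetric] d_def[symmetric] p_def[symmetric]
      by (simp add: nn_integral_add nn_integral_sum del: sum_ennreal)
  qed
  have dfin: "(\<integral>\<^sup>+\<omega>. ennreal (norm (d j \<omega>) powr p) \<partial>M) < \<infinity>" if "j \<in> {1..n}" for j
  proof -
    have "(\<integral>\<^sup>+\<omega>. ennreal (norm (d j \<omega>) powr p) \<partial>M) \<le> ?D"
      unfolding D_eq using that by (intro add_increasing2 member_le_sum) auto
    then show ?thesis using False by (simp add: top.not_eq_extremum order_le_less_trans)
  qed
  have dint: "integrable M (\<lambda>\<omega>. norm (d j \<omega>) powr p)" if "j \<in> {1..n}" for j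
    using dfin[OF that] by (intro integrableI_bounded) auto
  have Xpint: "integrable M (\<lambda>\<omega>. norm (X j \<omega>) powr p)" if "j \<le> n" for j
    using that
  proof (induction j)
    case 0
    have "AE \<omega> in M. norm (X 0 \<omega>) powr p = 0" using X0 by eventually_elim simp
    then show ?case by (subst integrable_cong_AE[where g = "\<lambda>_. 0"]) auto
  next
    case (Suc j)
    have le: "norm (X (Suc j) \<omega>) powr p \<le> 2 powr p * (norm (X j \<omega>) powr p + norm (d (Suc j) \<omega>) powr p)" for \<omega>
    proof -
      have "X (Suc j) \<omega> = X j \<omega> + d (Suc j) \<omega>" by (simp add: dS)
      then have "norm (X (Suc j) \<omega>) powr p \<le> (norm (X j \<omega>) + norm (d (Suc j) \<omega>)) powr p"
        using p by (intro powr_mono2) (auto simp: norm_triangle_ineq)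
      also have "\<dots> \<le> 2 powr p * (norm (X j \<omega>) powr p + norm (d (Suc j) \<omega>) powr p)"
        using p by (intro powr_add_le) auto
      finally show ?thesis .
    qed
    have "integrable M (\<lambda>\<omega>. 2 powr p * (norm (X j \<omega>) powr p + norm (d (Suc j) \<omega>) powr p))"
      using Suc dint[of "Suc j"] by auto
    then show ?case
      by (rule Bochner_Integration.integrable_bound) (use le in \<open>auto intro!: AE_I2\<close>)
  qed
  have w_fin: "AE \<omega> in M. w j \<omega> = ennreal (enn2real (w j \<omega>))" if "j \<in> {1..n}" for j
  proof -
    interpret finite_measure_subalgebra M "F (j - 1)" by unfold_locales (rule sub)
    have "(\<integral>\<^sup>+\<omega>. w j \<omega> \<partial>M) = (\<integral>\<^sup>+\<omega>. ennreal ((norm (d j \<omega>))\<^sup>2) \<partial>M)"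
      using nn_cond_exp_intg[of "\<lambda>_. 1" "\<lambda>\<omega>. ennreal ((norm (d j \<omega>))\<^sup>2)"] by (simp add: w_def)
    also have "\<dots> \<le> (\<integral>\<^sup>+\<omega>. ennreal (1 + norm (d j \<omega>) powr p) \<partial>M)"
      using p by (intro nn_integral_mono ennreal_leI square_le_one_add_powr) auto
    also have "\<dots> = 1 + (\<integral>\<^sup>+\<omega>. ennreal (norm (d j \<omega>) powr p) \<partial>M)"
      by (simp add: nn_integral_add emeasure_space_1)
    also have "\<dots> < \<infinity>" using dfin[OF that] by simp
    finally have "AE \<omega> in M. w j \<omega> \<noteq> \<infinity>" by (intro nn_integral_PInf_AE) auto
    then show ?thesis by eventually_elim (simp add: top.not_eq_extremum)
  qed
  have epowr_S: "(\<integral>\<^sup>+\<omega>. epowr (\<Sum>j=1..n. w j \<omega>) q \<partial>M) = (\<integral>\<^sup>+\<omega>. ennreal (S n \<omega> powr q) \<partial>M)"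
  proof (rule nn_integral_cong_AE)
    have "AE \<omega> in M. \<forall>j\<in>{1..n}. w j \<omega> = ennreal (enn2real (w j \<omega>))"
      using w_fin by (subst AE_finite_all) auto
    then show "AE \<omega> in M. epowr (\<Sum>j=1..n. w j \<omega>) q = ennreal (S n \<omega> powr q)"
    proof eventually_elim
      case (elim \<omega>)
      then have "(\<Sum>j=1..n. w j \<omega>) = (\<Sum>j=1..n. ennreal (enn2real (w j \<omega>)))"
        by (intro sum.cong) auto
      also have "\<dots> = ennreal (S n \<omega>)" unfolding S_def by (rule sum_ennreal) simp
      finally show ?case using S0 by (simp add: epowr_def)
    qed
  qed
  have Snfin: "(\<integral>\<^sup>+\<omega>. ennreal (S n \<omega> powr q) \<partial>M) < \<infinity>"
    using False unfolding D_eq epowr_S by (simp add: top.not_eq_extremum)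
  have Sint: "integrable M (\<lambda>\<omega>. S j \<omega> powr q)" if "j \<le> n" for j
  proof (rule Bochner_Integration.integrable_bound)
    show "integrable M (\<lambda>\<omega>. S n \<omega> powr q)"
      using Snfin by (intro integrableI_bounded) auto
    have "S j \<omega> \<le> S n \<omega>" for \<omega>
      unfolding S_def using that by (intro sum_mono2) auto
    then show "AE \<omega> in M. norm (S j \<omega> powr q) \<le> norm (S n \<omega> powr q)"
      using q S0 by (intro AE_I2) (auto intro!: powr_mono2)
  qed measurable
  have main: "(\<integral>\<omega>. U ((norm (X j \<omega>))\<^sup>2) (S j \<omega>) \<partial>M)
      \<le> B * (\<integral>\<omega>. S j \<omega> powr q \<partial>M) + C * (\<Sum>i=1..j. \<integral>\<omega>. norm (d i \<omega>) powr p \<partial>M)" if "j \<le> n" for j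
    using that
  proof (induction j)
    case 0
    have "AE \<omega> in M. U ((norm (X 0 \<omega>))\<^sup>2) (S 0 \<omega>) = 0"
      using X0
    proof eventually_elim
      case (elim \<omega>)
      \<comment> \<open>\<open>U 0 0\<close> is squeezed between 0 and
        \<open>0 powr q = 0\<close>.\<close>
      then show ?case using U_nonneg[of 0 0] U_le[of 0 0] by (simp add: S_def)
    qed
    then have "(\<integral>\<omega>. U ((norm (X 0 \<omega>))\<^sup>2) (S 0 \<omega>) \<partial>M) = 0"
      by (rule integral_eq_zero_AE)
    then show ?case by (simp add: S_def)
  next
    case (Suc j)
    have "(\<integral>\<omega>. U ((norm (X j \<omega> + d (Suc j) \<omega>))\<^sup>2) (S j \<omega> + enn2real (w (Suc j) \<omega>)) \<partial>M)
     \<le> (\<integral>\<omega>. U ((norm (X j \<omega>))\<^sup>2) (S j \<omega>) \<partial>M)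
       + B * ((\<integral>\<omega>. (S j \<omega> + enn2real (w (Suc j) \<omega>)) powr q \<partial>M) - (\<integral>\<omega>. S j \<omega> powr q \<partial>M))
       + C * (\<integral>\<omega>. norm (d (Suc j) \<omega>) powr (2 * q) \<partial>M)"
    proof (rule one_step[OF M sub[of j] adapted[of j]])
      show "S j \<in> borel_measurable (F j)" by (rule S_pred) simp
      show "(\<lambda>\<omega>. enn2real (w (Suc j) \<omega>)) \<in> borel_measurable (F j)"
        by (intro borel_measurable_enn2real w_pred) simp
      show "integrable M (d (Suc j))" unfolding d_def incr_def using Xint by simp
      show "set_lebesgue_integral M E (d (Suc j)) = 0" if "E \<in> sets (F j)" for E
      proof -
        have E: "E \<in> sets M" using that sub by (auto simp: subalgebra_def)
        have "set_lebesgue_integral M E (d (Suc j))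
            = set_lebesgue_integral M E (X (Suc j)) - set_lebesgue_integral M E (X j)"
          unfolding d_def incr_def set_lebesgue_integral_def scaleR_diff_right
          using Xint E by (simp add: integrable_mult_indicator)
        then show ?thesis using mce[of j "Suc j"] that by (simp add: has_cond_exp_def)
      qed
      show "AE \<omega> in M. nn_cond_exp M (F j) (\<lambda>\<omega>. ennreal ((norm (d (Suc j) \<omega>))\<^sup>2)) \<omega>
          = ennreal (enn2real (w (Suc j) \<omega>))"
        using w_fin[of "Suc j"] Suc.prems by (simp add: w_def)
    qed (use Suc.prems Xpint[of j] dint[of "Suc j"] Sint[of j] Sint[of "Suc j"] S0 in
        \<open>auto simp: p_def S_Suc\<close>)
    then show ?case
      using Suc by (simp add: S_Suc dS p_def algebra_simps)
  qed
  have c1: "0 \<le> c1" and c2: "0 \<le> c2" using nonneg by auto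
  have Uint: "integrable M (\<lambda>\<omega>. U ((norm (X n \<omega>))\<^sup>2) (S n \<omega>))"
  proof (rule Bochner_Integration.integrable_bound[OF Xpint[OF order_refl]])
    have "(\<lambda>\<omega>. ((norm (X n \<omega>))\<^sup>2, S n \<omega>)) \<in> M \<rightarrow>\<^sub>M borel \<Otimes>\<^sub>M borel" by measurable
    from measurable_compose[OF this measurable_U]
    show "(\<lambda>\<omega>. U ((norm (X n \<omega>))\<^sup>2) (S n \<omega>)) \<in> borel_measurable M" by simp
    show "AE \<omega> in M. norm (U ((norm (X n \<omega>))\<^sup>2) (S n \<omega>)) \<le> norm (norm (X n \<omega>) powr p)"
      using U_nonneg U_le S0 unfolding p_def by (auto intro!: AE_I2 simp flip: power2_powr)
  qed
  have "(\<integral>\<omega>. norm (X n \<omega>) powr p \<partial>M) \<le> (\<integral>\<omega>. c1 * U ((norm (X n \<omega>))\<^sup>2) (S n \<omega>) + c2 * S n \<omega> powr q \<partial>M)"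
  proof (rule integral_mono)
    show "norm (X n \<omega>) powr p \<le> c1 * U ((norm (X n \<omega>))\<^sup>2) (S n \<omega>) + c2 * S n \<omega> powr q" for \<omega>
      using majorant[of "(norm (X n \<omega>))\<^sup>2" "S n \<omega>"] S0 by (simp add: power2_powr p_def)
  qed (use Xpint Uint Sint in auto)
  also have "\<dots> = c1 * (\<integral>\<omega>. U ((norm (X n \<omega>))\<^sup>2) (S n \<omega>) \<partial>M) + c2 * (\<integral>\<omega>. S n \<omega> powr q \<partial>M)"
    using Uint Sint by simp
  also have "\<dots> \<le> c1 * (B * (\<integral>\<omega>. S n \<omega> powr q \<partial>M) + C * (\<Sum>i=1..n. \<integral>\<omega>. norm (d i \<omega>) powr p \<partial>M))
      + c2 * (\<integral>\<omega>. S n \<omega> powr q \<partial>M)"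
    using c1 main by (intro add_right_mono mult_left_mono) auto
  also have "\<dots> = (c1 * B + c2) * (\<integral>\<omega>. S n \<omega> powr q \<partial>M)
      + (c1 * C) * (\<Sum>i=1..n. \<integral>\<omega>. norm (d i \<omega>) powr p \<partial>M)"
    by (simp add: algebra_simps)
  also have "\<dots> \<le> K * (\<integral>\<omega>. S n \<omega> powr q \<partial>M) + K * (\<Sum>i=1..n. \<integral>\<omega>. norm (d i \<omega>) powr p \<partial>M)"
    using K by (intro add_mono mult_right_mono sum_nonneg) auto
  finally have fin: "(\<integral>\<omega>. norm (X n \<omega>) powr p \<partial>M)
      \<le> K * ((\<Sum>i=1..n. \<integral>\<omega>. norm (d i \<omega>) powr p \<partial>M) + (\<integral>\<omega>. S n \<omega> powr q \<partial>M))"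
    by (simp add: algebra_simps)
  have "?D = (\<Sum>i=1..n. ennreal (\<integral>\<omega>. norm (d i \<omega>) powr p \<partial>M)) + ennreal (\<integral>\<omega>. S n \<omega> powr q \<partial>M)"
    unfolding D_eq epowr_S using dint Sint
    by (simp add: nn_integral_eq_integral)
  also have "\<dots> = ennreal ((\<Sum>i=1..n. \<integral>\<omega>. norm (d i \<omega>) powr p \<partial>M) + (\<integral>\<omega>. S n \<omega> powr q \<partial>M))"
    by (simp add: sum_ennreal sum_nonneg)
  finally have D: "?D = ennreal ((\<Sum>i=1..n. \<integral>\<omega>. norm (d i \<omega>) powr p \<partial>M) + (\<integral>\<omega>. S n \<omega> powr q \<partial>M))" .
  have "(\<integral>\<^sup>+\<omega>. ennreal (norm (X n \<omega>) powr (2 * q)) \<partial>M) = ennreal (\<integral>\<omega>. norm (X n \<omega>) powr p \<partial>M)"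
    unfolding p_def[symmetric] using Xpint by (intro nn_integral_eq_integral) auto
  also have "\<dots> \<le> ennreal (K * ((\<Sum>i=1..n. \<integral>\<omega>. norm (d i \<omega>) powr p \<partial>M) + (\<integral>\<omega>. S n \<omega> powr q \<partial>M)))"
    by (rule ennreal_leI[OF fin])
  also have "\<dots> = ennreal K * ?D"
    unfolding D using K by (simp add: ennreal_mult sum_nonneg)
  finally show ?thesis .
qed

subsection \<open>Exceedances\<close>

lemma ennreal_divide_mult:
  fixes c y :: real
  assumes "0 < c" "0 < y"
  shows "x / ennreal (c * y) = ennreal (1 / c) * (x / ennreal y)"
proof -
  have "inverse (ennreal (c * y)) = ennreal (1 / c) * inverse (ennreal y)"
    using assms by (simp add: inverse_ennreal ennreal_mult[symmetric] inverse_eq_divide)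
  then show ?thesis by (simp only: divide_ennreal_def mult_ac)
qed

text \<open>Layer-cake form, valid also for infinite \<open>N\<close>; integrating it term by term
  produces tail probabilities.\<close>

lemma S_sum_eq_suminf:
  "S_sum a N = (\<Sum>n. ennreal (a (Suc n)) * (if enat (Suc n) \<le> N then 1 else 0))"
proof (cases N)
  case (enat k)
  have "(\<Sum>n. ennreal (a (Suc n)) * (if enat (Suc n) \<le> N then 1 else 0))
      = (\<Sum>n<k. ennreal (a (Suc n)) * (if enat (Suc n) \<le> N then 1 else 0))"
    by (rule suminf_finite) (auto simp: enat)
  also have "\<dots> = (\<Sum>n<k. ennreal (a (Suc n)))"
    by (intro sum.cong) (auto simp: enat)
  finally show ?thesis by (simp add: S_sum_def enat)
qed (simp add: S_sum_def)

lemma S_sum_mono: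
  assumes "N \<le> N'"
  shows "S_sum a N \<le> S_sum a N'"
  unfolding S_sum_eq_suminf
proof (rule suminf_le)
  fix n
  have "enat (Suc n) \<le> N'" if "enat (Suc n) \<le> N" using that assms by (rule order_trans)
  then show "ennreal (a (Suc n)) * (if enat (Suc n) \<le> N then 1 else 0)
      \<le> ennreal (a (Suc n)) * (if enat (Suc n) \<le> N' then 1 else 0)" by simp
qed (rule summableI)+

text \<open>Turns the supremum into a countable union of events, also when there are infinitely many
  exceedances. The case \<open>k = 0\<close> is excluded because the supremum of the empty set is
  0.\<close>

lemma enat_le_last_exceed_iff:
  assumes "1 \<le> k"
  shows "enat k \<le> last_exceed X e \<omega> \<longleftrightarrow> (\<exists>m\<ge>k. e m < norm (X m \<omega> /\<^sub>R real m))"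
proof
  assume *: "enat k \<le> last_exceed X e \<omega>"
  show "\<exists>m\<ge>k. e m < norm (X m \<omega> /\<^sub>R real m)"
  proof (rule ccontr)
    assume no: "\<not> ?thesis"
    have "m \<le> k - 1" if "e m < norm (X m \<omega> /\<^sub>R real m)" for m
    proof -
      have "m < k" using no that by (meson not_less)
      then show ?thesis by simp
    qed
    then have "last_exceed X e \<omega> \<le> enat (k - 1)"
      unfolding last_exceed_def by (intro Sup_least) auto
    with * have "enat k \<le> enat (k - 1)" by (rule order_trans)
    then show False using assms by simp
  qed
next
  assume "\<exists>m\<ge>k. e m < norm (X m \<omega> /\<^sub>R real m)"
  then obtain m where m: "k \<le> m" "e m < norm (X m \<omega> /\<^sub>R real m)" by blast
  have "enat k \<le> enat m" using m by simp
  also have "\<dots> \<le> last_exceed X e \<omega>"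
    unfolding last_exceed_def using m assms by (intro Sup_upper) auto
  finally show "enat k \<le> last_exceed X e \<omega>" .
qed

lemma exceed_count_le_last_exceed: "exceed_count X e \<omega> \<le> last_exceed X e \<omega>"
proof -
  define P where "P n \<longleftrightarrow> norm (X (Suc n) \<omega> /\<^sub>R real (Suc n)) > e (Suc n)" for n
  \<comment> \<open>The second bound strengthens the induction: at an exceedance with index
    \<open>Suc n\<close> the count is at most \<open>Suc n\<close>, which is at most the last
    exceedance time.\<close>
  have "(\<Sum>i<n. if P i then 1 else 0) \<le> last_exceed X e \<omega> \<and> (\<Sum>i<n. if P i then 1 else 0) \<le> enat n" for n
  proof (induction n)
    case 0
    then show ?case by (simp add: zero_enat_def[symmetric])
  next
    case (Suc n)
    show ?case
    proof (cases "P n")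
      case True
      then have "enat (Suc n) \<le> last_exceed X e \<omega>"
        by (subst enat_le_last_exceed_iff) (auto simp: P_def)
      moreover have "(\<Sum>i<Suc n. if P i then 1 else 0) \<le> enat n + 1"
        using Suc True by (simp add: add_right_mono)
      moreover have "enat n + 1 = enat (Suc n)" by (simp add: one_enat_def)
      ultimately show ?thesis by (auto intro: order_trans)
    next
      case False
      then show ?thesis using Suc by (auto intro: order_trans)
    qed
  qed
  then show ?thesis
    unfolding exceed_count_def P_def[symmetric] suminf_eq_SUP by (auto intro: SUP_least)
qed

text \<open>Markov's inequality for the \<open>p\<close>-th power. The factor \<open>n\<close> in
  the moment bound lowers \<open>n powr p\<close> to \<open>n powr (p - 1)\<close>.\<close>

lemma tail_probability_le:
  fixes Y :: "'a \<Rightarrow> 'h::{real_inner, banach, second_countable_topology}"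
  assumes [measurable]: "Y \<in> borel_measurable M"
    and n: "1 \<le> n" and e: "0 < e" and K: "0 < K" and p: "0 < p"
    and moment: "(\<integral>\<^sup>+\<omega>. ennreal (norm (Y \<omega>) powr p) \<partial>M) \<le> ennreal K * (ennreal (real n) * b)"
  shows "emeasure M {\<omega> \<in> space M. e < norm (Y \<omega> /\<^sub>R real n)}
    \<le> ennreal K * (b / ennreal (e powr p * real n powr (p - 1)))"
proof -
  define c where "c = 1 / (e * real n) powr p"
  have c: "0 < c" using e n by (simp add: c_def)
  have "emeasure M {\<omega> \<in> space M. e < norm (Y \<omega> /\<^sub>R real n)}
      \<le> emeasure M ({\<omega> \<in> space M. 1 \<le> ennreal c * ennreal (norm (Y \<omega>) powr p)})"
  proof (intro emeasure_mono)
    show "{\<omega> \<in> space M. e < norm (Y \<omega> /\<^sub>R real n)}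
        \<subseteq> {\<omega> \<in> space M. 1 \<le> ennreal c * ennreal (norm (Y \<omega>) powr p)}"
    proof safe
      fix \<omega> assume "e < norm (Y \<omega> /\<^sub>R real n)"
      then have "e * real n \<le> norm (Y \<omega>)" using n by (simp add: field_simps)
      then have "(e * real n) powr p \<le> norm (Y \<omega>) powr p"
        using p e by (intro powr_mono2) auto
      then have "1 \<le> c * norm (Y \<omega>) powr p" using e n by (simp add: c_def field_simps)
      then have "ennreal 1 \<le> ennreal (c * norm (Y \<omega>) powr p)" by (rule ennreal_leI)
      then show "1 \<le> ennreal c * ennreal (norm (Y \<omega>) powr p)" using c by (simp add: ennreal_mult)
    qed
  qed measurable
  also have "\<dots> \<le> ennreal c * (\<integral>\<^sup>+\<omega>. ennreal (norm (Y \<omega>) powr p) * indicator (space M) \<omega> \<partial>M)"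
    by (intro nn_integral_Markov_inequality) auto
  also have "(\<integral>\<^sup>+\<omega>. ennreal (norm (Y \<omega>) powr p) * indicator (space M) \<omega> \<partial>M)
      = (\<integral>\<^sup>+\<omega>. ennreal (norm (Y \<omega>) powr p) \<partial>M)"
    by (intro nn_integral_cong) auto
  also have "ennreal c * \<dots> \<le> ennreal c * (ennreal K * (ennreal (real n) * b))"
    by (intro mult_left_mono moment) auto
  also have "\<dots> = ennreal K * (b * (ennreal c * ennreal (real n)))"
    by (simp add: mult_ac)
  also have "ennreal c * ennreal (real n) = ennreal (1 / (e powr p * real n powr (p - 1)))"
    using e n by (simp add: c_def ennreal_mult[symmetric] powr_mult powr_diff)
  also have "b * ennreal (1 / (e powr p * real n powr (p - 1))) = b / ennreal (e powr p * real n powr (p - 1))"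
    using e n by (simp add: divide_ennreal_def inverse_ennreal inverse_eq_divide)
  finally show ?thesis .
qed

lemma mult_moment_beta:
  fixes X :: "nat \<Rightarrow> 'a \<Rightarrow> 'h::real_normed_vector"
  assumes "1 \<le> n"
  shows "ennreal (real n) * moment_beta M F X p n =
    (\<integral>\<^sup>+ \<omega>. (\<Sum>j=1..n. ennreal (norm (incr X j \<omega>) powr p)) +
      epowr (\<Sum>j=1..n. nn_cond_exp M (F (j - 1)) (\<lambda>\<omega>'. ennreal ((norm (incr X j \<omega>'))\<^sup>2)) \<omega>) (p / 2) \<partial>M)"
proof -
  have "ennreal (real n) * (y / ennreal (real n)) = y" for y
    using assms by (simp add: ennreal_times_divide mult.commute[of "ennreal (real n)"] mult_divide_eq_ennreal)
  then show ?thesis unfolding moment_beta_def .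
qed

lemma martingale_moment_bound:
  fixes X :: "nat \<Rightarrow> 'a \<Rightarrow> 'h::{real_inner, banach, second_countable_topology}"
  assumes "prob_space M" "martingale M F X" "AE \<omega> in M. X 0 \<omega> = 0" "2 \<le> p"
  obtains K where "0 < K" "K < C_const p"
    "\<And>n. 1 \<le> n \<Longrightarrow> (\<integral>\<^sup>+\<omega>. ennreal (norm (X n \<omega>) powr p) \<partial>M)
      \<le> ennreal K * (ennreal (real n) * moment_beta M F X p n)"
proof -
  define q where "q = p / 2"
  have q: "1 \<le> q" and p: "p = 2 * q" using assms by (auto simp: q_def)
  obtain c1 c2 B C k U g A where bell: "bellman q c1 c2 B C k U g A"
    and c: "c1 * B + c2 < C_const p" "c1 * C < C_const p"
    using bellman_exists[OF q] p by metis
  interpret bellman q c1 c2 B C k U g A by (rule bell)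
  have C0: "0 < C_const p" using c(1) nonneg by (smt (verit) mult_nonneg_nonneg)
  \<comment> \<open>The Bellman constants are merely nonnegative; the entry
    \<open>C_const p / 2\<close> makes \<open>K\<close> positive while keeping it below
    \<open>C_const p\<close>.\<close>
  define K where "K = max (C_const p / 2) (max (c1 * B + c2) (c1 * C))"
  have K: "0 < K" "K < C_const p" "c1 * B + c2 \<le> K" "c1 * C \<le> K"
    using C0 c by (auto simp: K_def)
  show thesis
  proof (rule that[OF K(1,2)])
    fix n :: nat assume n: "1 \<le> n"
    show "(\<integral>\<^sup>+\<omega>. ennreal (norm (X n \<omega>) powr p) \<partial>M)
      \<le> ennreal K * (ennreal (real n) * moment_beta M F X p n)"
      unfolding mult_moment_beta[OF n] unfolding q_def[symmetric] unfolding p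
      by (rule rosenthal[OF assms(1-3) K(1,3,4)])
  qed
qed

section \<open>Tail estimates from a moment bound\<close>

context
  fixes M :: "'a measure" and F :: "nat \<Rightarrow> 'a measure"
    and X :: "nat \<Rightarrow> 'a \<Rightarrow> 'h::{real_inner, banach, second_countable_topology}"
    and p K :: real
  assumes M: "prob_space M" and X [measurable]: "\<And>n. X n \<in> borel_measurable M"
    and p: "2 \<le> p" and K: "0 < K"
    and moment: "\<And>n. 1 \<le> n \<Longrightarrow> (\<integral>\<^sup>+\<omega>. ennreal (norm (X n \<omega>) powr p) \<partial>M)
      \<le> ennreal K * (ennreal (real n) * moment_beta M F X p n)"
begin

lemma emeasure_exceed_le:
  assumes "1 \<le> n" "0 < e n"
  shows "emeasure M {\<omega> \<in> space M. e n < norm (X n \<omega> /\<^sub>R real n)}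
    \<le> ennreal K * (moment_beta M F X p n / ennreal (e n powr p * real n powr (p - 1)))"
  by (rule tail_probability_le[OF X assms K _ moment[OF assms(1)]]) (use p in simp)

lemma last_exceed_sets [measurable]:
  assumes "1 \<le> k"
  shows "{\<omega> \<in> space M. enat k \<le> last_exceed X e \<omega>} \<in> sets M"
  unfolding enat_le_last_exceed_iff[OF assms] by measurable

lemma emeasure_last_exceed_le:
  assumes k: "1 \<le> k" and e: "\<And>n. 1 \<le> n \<Longrightarrow> 0 < e n"
  shows "emeasure M {\<omega> \<in> space M. enat k \<le> last_exceed X e \<omega>}
    \<le> ennreal K * (\<Sum>i. moment_beta M F X p (k + i) / ennreal (e (k + i) powr p * real (k + i) powr (p - 1)))"
proof -
  have ex: "(\<exists>m\<ge>k. P m) \<longleftrightarrow> (\<exists>i. P (k + i))" for P by (auto simp: le_iff_add)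
  have "{\<omega> \<in> space M. enat k \<le> last_exceed X e \<omega>}
      = (\<Union>i. {\<omega> \<in> space M. e (k + i) < norm (X (k + i) \<omega> /\<^sub>R real (k + i))})"
    unfolding enat_le_last_exceed_iff[OF k] ex by blast
  then have "emeasure M {\<omega> \<in> space M. enat k \<le> last_exceed X e \<omega>}
      \<le> (\<Sum>i. emeasure M {\<omega> \<in> space M. e (k + i) < norm (X (k + i) \<omega> /\<^sub>R real (k + i))})"
    by (simp only:) (rule emeasure_subadditive_countably, auto)
  also have "\<dots> \<le> (\<Sum>i. ennreal K * (moment_beta M F X p (k + i) / ennreal (e (k + i) powr p * real (k + i) powr (p - 1))))"
    using k e by (intro suminf_le summableI emeasure_exceed_le) auto
  finally show ?thesis by simp
qed

lemma nn_integral_last_exceed: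
  "(\<integral>\<^sup>+\<omega>. S_sum a (last_exceed X e \<omega>) \<partial>M)
    = (\<Sum>n. ennreal (a (Suc n)) * emeasure M {\<omega> \<in> space M. enat (Suc n) \<le> last_exceed X e \<omega>})"
proof -
  have "(\<integral>\<^sup>+\<omega>. S_sum a (last_exceed X e \<omega>) \<partial>M)
      = (\<integral>\<^sup>+\<omega>. (\<Sum>n. ennreal (a (Suc n)) * indicator {\<omega> \<in> space M. enat (Suc n) \<le> last_exceed X e \<omega>} \<omega>) \<partial>M)"
    unfolding S_sum_eq_suminf by (intro nn_integral_cong suminf_cong) (auto simp: indicator_def)
  also have "\<dots> = (\<Sum>n. \<integral>\<^sup>+\<omega>. ennreal (a (Suc n)) * indicator {\<omega> \<in> space M. enat (Suc n) \<le> last_exceed X e \<omega>} \<omega> \<partial>M)"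
    by (rule nn_integral_suminf) measurable
  also have "\<dots> = (\<Sum>n. ennreal (a (Suc n)) * emeasure M {\<omega> \<in> space M. enat (Suc n) \<le> last_exceed X e \<omega>})"
    by (intro suminf_cong nn_integral_cmult_indicator) measurable
  finally show ?thesis .
qed

lemma nn_integral_last_exceed_le:
  assumes e: "\<And>n. 1 \<le> n \<Longrightarrow> 0 < e n"
  shows "(\<integral>\<^sup>+\<omega>. S_sum a (last_exceed X e \<omega>) \<partial>M) \<le> ennreal K * K_weighted_tol M F X p a e"
proof -
  have "(\<integral>\<^sup>+\<omega>. S_sum a (last_exceed X e \<omega>) \<partial>M)
      \<le> (\<Sum>n. ennreal (a (Suc n)) * (ennreal K *
          (\<Sum>i. moment_beta M F X p (Suc n + i) / ennreal (e (Suc n + i) powr p * real (Suc n + i) powr (p - 1)))))"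
    unfolding nn_integral_last_exceed
    by (intro suminf_le summableI mult_left_mono emeasure_last_exceed_le e) auto
  also have "\<dots> = ennreal K * K_weighted_tol M F X p a e"
    unfolding K_weighted_tol_def ennreal_suminf_cmult[symmetric] by (simp only: mult.left_commute)
  finally show ?thesis .
qed

text \<open>The Borel--Cantelli lemma. Constant tolerances \<open>1 / (m + 1)\<close> lead to the
  strong law, general ones to the limsup statement.\<close>

lemma eventually_not_exceed:
  assumes e: "\<And>n. 1 \<le> n \<Longrightarrow> 0 < e n"
    and fin: "(\<Sum>i. moment_beta M F X p (Suc i) / ennreal (e (Suc i) powr p * real (Suc i) powr (p - 1))) < \<infinity>"
  shows "AE \<omega> in M. \<forall>\<^sub>F n in sequentially. norm (X n \<omega> /\<^sub>R real n) \<le> e n"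
proof -
  interpret prob_space M by (rule M)
  define E where "E n = {\<omega> \<in> space M. e (Suc n) < norm (X (Suc n) \<omega> /\<^sub>R real (Suc n))}" for n
  have [measurable]: "E n \<in> sets M" for n unfolding E_def by measurable
  have "(\<Sum>n. emeasure M (E n))
      \<le> (\<Sum>n. ennreal K * (moment_beta M F X p (Suc n) / ennreal (e (Suc n) powr p * real (Suc n) powr (p - 1))))"
    unfolding E_def using e by (intro suminf_le summableI emeasure_exceed_le) auto
  also have "\<dots> < \<infinity>" using fin by (simp add: ennreal_mult_less_top)
  finally have "summable (\<lambda>n. measure M (E n))"
    by (intro summable_suminf_not_top) (auto simp: emeasure_eq_measure)
  then have "AE \<omega> in M. \<forall>\<^sub>F n in sequentially. \<omega> \<in> space M - E n"
    by (intro borel_cantelli_AE1) (auto simp: less_top[symmetric])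
  then show ?thesis
  proof eventually_elim
    case (elim \<omega>)
    then have "\<forall>\<^sub>F n in sequentially. norm (X (Suc n) \<omega> /\<^sub>R real (Suc n)) \<le> e (Suc n)"
      by eventually_elim (auto simp: E_def)
    then show ?case by (rule eventually_sequentially_Suc[THEN iffD1])
  qed
qed

end


section \<open>The strong law and the exceedance estimates\<close>

lemma K_weighted_tol_const:
  assumes "0 < \<epsilon>"
  shows "K_weighted_tol M F X p a (\<lambda>_. \<epsilon>) = ennreal (1 / \<epsilon> powr p) * K_weighted M F X p a"
proof -
  have "moment_beta M F X p (Suc n + i) / ennreal (\<epsilon> powr p * real (Suc n + i) powr (p - 1))
      = ennreal (1 / \<epsilon> powr p) * (moment_beta M F X p (Suc n + i) / ennreal (real (Suc n + i) powr (p - 1)))" for n i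
    using assms by (intro ennreal_divide_mult) auto
  then show ?thesis
    unfolding K_weighted_tol_def K_weighted_def ennreal_suminf_cmult
    by (simp only: mult.left_commute[of "ennreal (a _)"] ennreal_suminf_cmult)
qed

text \<open>Multiplying \<open>X\<close> and \<epsilon> by the same positive constant leaves the
  exceedances unchanged, while \<open>K_weighted\<close> scales with its \<open>p\<close>-th power;
  hence the factor \<open>1 / \<epsilon> powr p\<close>. If \<open>K_weighted\<close> is 0, both
  sides of the expectation bound vanish, so strictness is claimed for positive values.\<close>

theorem theorem6:
  fixes M :: "'a measure"
    and F :: "nat \<Rightarrow> 'a measure"
    and X :: "nat \<Rightarrow> 'a \<Rightarrow> 'h::{real_inner, banach, second_countable_topology}"
    and p :: real
  assumes "prob_space M"
    and "martingale M F X"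
    and "AE \<omega> in M. X 0 \<omega> = 0"
    and "2 \<le> p"
    and "K_moment M F X p < \<infinity>"
  shows "(AE \<omega> in M. (\<lambda>n. X n \<omega> /\<^sub>R real n) \<longlonglongrightarrow> 0)
    \<and> (\<forall>(\<epsilon>::real) (a :: nat \<Rightarrow> real).
          0 < \<epsilon> \<and> (\<forall>n\<ge>1. 0 < a n) \<and> mono_on {1..} a \<and> K_weighted M F X p a < \<infinity> \<longrightarrow>
            (\<integral>\<^sup>+ \<omega>. S_sum a (exceed_count X (\<lambda>_. \<epsilon>) \<omega>) \<partial>M)
              \<le> (\<integral>\<^sup>+ \<omega>. S_sum a (last_exceed X (\<lambda>_. \<epsilon>) \<omega>) \<partial>M)
          \<and> (\<integral>\<^sup>+ \<omega>. S_sum a (last_exceed X (\<lambda>_. \<epsilon>) \<omega>) \<partial>M)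
              \<le> ennreal (C_const p / \<epsilon> powr p) * K_weighted M F X p a
          \<and> (0 < K_weighted M F X p a \<longrightarrow>
              (\<integral>\<^sup>+ \<omega>. S_sum a (last_exceed X (\<lambda>_. \<epsilon>) \<omega>) \<partial>M)
                < ennreal (C_const p / \<epsilon> powr p) * K_weighted M F X p a)
          \<and> (\<forall>k::nat. 1 \<le> k \<longrightarrow>
              emeasure M {\<omega> \<in> space M. enat k \<le> exceed_count X (\<lambda>_. \<epsilon>) \<omega>}
                \<le> emeasure M {\<omega> \<in> space M. enat k \<le> last_exceed X (\<lambda>_. \<epsilon>) \<omega>}
            \<and> emeasure M {\<omega> \<in> space M. enat k \<le> last_exceed X (\<lambda>_. \<epsilon>) \<omega>}
                \<le> inverse (S_sum a (enat k)) * ennreal (C_const p / \<epsilon> powr p) * K_weighted M F X p a))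
    \<and> (\<forall>(e :: nat \<Rightarrow> real) (a :: nat \<Rightarrow> real).
          (\<forall>n\<ge>1. 0 < e n) \<and> antimono_on {1..} e \<and> (\<forall>n\<ge>1. 0 < a n) \<and> mono_on {1..} a \<and>
          K_weighted_tol M F X p a e < \<infinity> \<longrightarrow>
            (AE \<omega> in M. limsup (\<lambda>n. ereal (norm (X n \<omega> /\<^sub>R real n) * inverse (e n))) \<le> 1)
          \<and> (\<integral>\<^sup>+ \<omega>. S_sum a (exceed_count X e \<omega>) \<partial>M)
              \<le> (\<integral>\<^sup>+ \<omega>. S_sum a (last_exceed X e \<omega>) \<partial>M)
          \<and> (\<integral>\<^sup>+ \<omega>. S_sum a (last_exceed X e \<omega>) \<partial>M)
              \<le> ennreal (C_const p) * K_weighted_tol M F X p a e)"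

proof -
  obtain K where K: "0 < K" "K < C_const p"
    and moment: "\<And>n. 1 \<le> n \<Longrightarrow> (\<integral>\<^sup>+\<omega>. ennreal (norm (X n \<omega>) powr p) \<partial>M)
      \<le> ennreal K * (ennreal (real n) * moment_beta M F X p n)"
    using martingale_moment_bound[OF assms(1-4)] by blast
  have [measurable]: "X n \<in> borel_measurable M" for n
    using assms(2) measurable_from_subalg[of M "F n" "X n"] by (auto simp: martingale_def)
  note tail = assms(1) \<open>\<And>n. X n \<in> borel_measurable M\<close> assms(4) K(1) moment
  have count_le: "(\<integral>\<^sup>+ \<omega>. S_sum a (exceed_count X e \<omega>) \<partial>M) \<le> (\<integral>\<^sup>+ \<omega>. S_sum a (last_exceed X e \<omega>) \<partial>M)"
    for a e by (intro nn_integral_mono S_sum_mono exceed_count_le_last_exceed)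
  have conv: "AE \<omega> in M. (\<lambda>n. X n \<omega> /\<^sub>R real n) \<longlonglongrightarrow> 0"
  proof -
    have "AE \<omega> in M. \<forall>\<^sub>F n in sequentially. norm (X n \<omega> /\<^sub>R real n) \<le> 1 / real (Suc m)" for m
    proof (rule eventually_not_exceed[OF tail, where e = "\<lambda>_. 1 / real (Suc m)"])
      have "moment_beta M F X p (Suc i) / ennreal ((1 / real (Suc m)) powr p * real (Suc i) powr (p - 1))
        = ennreal (1 / (1 / real (Suc m)) powr p) * (moment_beta M F X p (Suc i) / ennreal (real (Suc i) powr (p - 1)))" for i
        by (intro ennreal_divide_mult) auto
      then show "(\<Sum>i. moment_beta M F X p (Suc i) / ennreal ((1 / real (Suc m)) powr p * real (Suc i) powr (p - 1))) < \<infinity>"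
        using assms(5) unfolding K_moment_def[symmetric]
        by (simp only: ennreal_suminf_cmult K_moment_def[symmetric]) (simp add: ennreal_mult_less_top)
    qed auto
    then have "AE \<omega> in M. \<forall>m. \<forall>\<^sub>F n in sequentially. norm (X n \<omega> /\<^sub>R real n) \<le> 1 / real (Suc m)"
      by (subst AE_all_countable) blast
    then show ?thesis
    proof eventually_elim
      case (elim \<omega>)
      show ?case
      proof (rule tendstoI)
        fix \<epsilon> :: real assume "0 < \<epsilon>"
        then obtain m where m: "1 / real (Suc m) < \<epsilon>"
          using reals_Archimedean[of \<epsilon>] by (auto simp: inverse_eq_divide)
        from elim[rule_format, of m] show "\<forall>\<^sub>F n in sequentially. dist (X n \<omega> /\<^sub>R real n) 0 < \<epsilon>"
          by eventually_elim (use m in simp)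
      qed
    qed
  qed
  moreover have "(\<integral>\<^sup>+ \<omega>. S_sum a (exceed_count X (\<lambda>_. \<epsilon>) \<omega>) \<partial>M)
              \<le> (\<integral>\<^sup>+ \<omega>. S_sum a (last_exceed X (\<lambda>_. \<epsilon>) \<omega>) \<partial>M)
          \<and> (\<integral>\<^sup>+ \<omega>. S_sum a (last_exceed X (\<lambda>_. \<epsilon>) \<omega>) \<partial>M)
              \<le> ennreal (C_const p / \<epsilon> powr p) * K_weighted M F X p a
          \<and> (0 < K_weighted M F X p a \<longrightarrow>
              (\<integral>\<^sup>+ \<omega>. S_sum a (last_exceed X (\<lambda>_. \<epsilon>) \<omega>) \<partial>M)
                < ennreal (C_const p / \<epsilon> powr p) * K_weighted M F X p a)
          \<and> (\<forall>k::nat. 1 \<le> k \<longrightarrow>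
              emeasure M {\<omega> \<in> space M. enat k \<le> exceed_count X (\<lambda>_. \<epsilon>) \<omega>}
                \<le> emeasure M {\<omega> \<in> space M. enat k \<le> last_exceed X (\<lambda>_. \<epsilon>) \<omega>}
            \<and> emeasure M {\<omega> \<in> space M. enat k \<le> last_exceed X (\<lambda>_. \<epsilon>) \<omega>}
                \<le> inverse (S_sum a (enat k)) * ennreal (C_const p / \<epsilon> powr p) * K_weighted M F X p a)"
    if \<epsilon>: "0 < \<epsilon>" and a: "\<forall>n\<ge>1. 0 < a n" and fin: "K_weighted M F X p a < \<infinity>" for \<epsilon> a
  proof (intro conjI impI allI count_le)
    let ?L = "\<lambda>k. {\<omega> \<in> space M. enat k \<le> last_exceed X (\<lambda>_. \<epsilon>) \<omega>}"
    have "(\<integral>\<^sup>+ \<omega>. S_sum a (last_exceed X (\<lambda>_. \<epsilon>) \<omega>) \<partial>M) \<le> ennreal K * K_weighted_tol M F X p a (\<lambda>_. \<epsilon>)"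
      using \<epsilon> by (intro nn_integral_last_exceed_le[OF tail]) auto
    also have "\<dots> = ennreal (K / \<epsilon> powr p) * K_weighted M F X p a"
      using \<epsilon> K by (simp add: K_weighted_tol_const mult.assoc[symmetric] ennreal_mult[symmetric])
    finally have bound: "(\<integral>\<^sup>+ \<omega>. S_sum a (last_exceed X (\<lambda>_. \<epsilon>) \<omega>) \<partial>M)
        \<le> ennreal (K / \<epsilon> powr p) * K_weighted M F X p a" .
    have lt: "ennreal (K / \<epsilon> powr p) < ennreal (C_const p / \<epsilon> powr p)"
      using K \<epsilon> by (intro ennreal_lessI) (auto intro!: divide_strict_right_mono)
    show le: "(\<integral>\<^sup>+ \<omega>. S_sum a (last_exceed X (\<lambda>_. \<epsilon>) \<omega>) \<partial>M)
        \<le> ennreal (C_const p / \<epsilon> powr p) * K_weighted M F X p a"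
      using lt by (intro order_trans[OF bound] mult_right_mono) auto
    show "(\<integral>\<^sup>+ \<omega>. S_sum a (last_exceed X (\<lambda>_. \<epsilon>) \<omega>) \<partial>M)
        < ennreal (C_const p / \<epsilon> powr p) * K_weighted M F X p a" if "0 < K_weighted M F X p a"
      using lt that fin by (intro order_le_less_trans[OF bound] ennreal_mult_strict_right_mono) auto
    fix k :: nat assume k: "1 \<le> k"
    have [measurable]: "?L k \<in> sets M" by (rule last_exceed_sets[OF tail k])
    show "emeasure M {\<omega> \<in> space M. enat k \<le> exceed_count X (\<lambda>_. \<epsilon>) \<omega>} \<le> emeasure M (?L k)"
      by (intro emeasure_mono) (auto intro: order_trans[OF _ exceed_count_le_last_exceed])
    define r where "r = (\<Sum>n<k. a (1 + n))"
    have r: "0 < r" unfolding r_def using a k by (intro sum_pos) (auto simp: lessThan_empty_iff)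
    have S: "S_sum a (enat k) = ennreal r"
      unfolding S_sum_def r_def using a by (simp add: sum_ennreal less_imp_le)
    \<comment> \<open>Markov's inequality for the nondecreasing function \<open>S_sum a\<close> of
      the last exceedance time.\<close>
    have "ennreal r * emeasure M (?L k) = (\<integral>\<^sup>+ \<omega>. S_sum a (enat k) * indicator (?L k) \<omega> \<partial>M)"
      by (simp add: S nn_integral_cmult_indicator)
    also have "\<dots> \<le> (\<integral>\<^sup>+ \<omega>. S_sum a (last_exceed X (\<lambda>_. \<epsilon>) \<omega>) \<partial>M)"
      by (intro nn_integral_mono) (auto simp: indicator_def intro: S_sum_mono)
    also note le
    finally have "inverse (ennreal r) * (ennreal r * emeasure M (?L k))
        \<le> inverse (ennreal r) * (ennreal (C_const p / \<epsilon> powr p) * K_weighted M F X p a)"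
      by (intro mult_left_mono) auto
    moreover have "inverse (ennreal r) * ennreal r = 1"
      using r by (simp add: inverse_ennreal ennreal_mult[symmetric])
    ultimately show "emeasure M (?L k)
        \<le> inverse (S_sum a (enat k)) * ennreal (C_const p / \<epsilon> powr p) * K_weighted M F X p a"
      unfolding S by (simp add: mult.assoc[symmetric])
  qed
  moreover have "(AE \<omega> in M. limsup (\<lambda>n. ereal (norm (X n \<omega> /\<^sub>R real n) * inverse (e n))) \<le> 1)
          \<and> (\<integral>\<^sup>+ \<omega>. S_sum a (exceed_count X e \<omega>) \<partial>M)
              \<le> (\<integral>\<^sup>+ \<omega>. S_sum a (last_exceed X e \<omega>) \<partial>M)
          \<and> (\<integral>\<^sup>+ \<omega>. S_sum a (last_exceed X e \<omega>) \<partial>M)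
              \<le> ennreal (C_const p) * K_weighted_tol M F X p a e"
    if e: "\<forall>n\<ge>1. 0 < e n" and a: "\<forall>n\<ge>1. 0 < a n" and fin: "K_weighted_tol M F X p a e < \<infinity>" for e a
  proof (intro conjI count_le)
    \<comment> \<open>\<open>?T 0\<close> is the Borel--Cantelli series. It carries the positive
      weight \<open>a 1\<close> in the weighted sum, so it inherits finiteness from it.\<close>
    let ?T = "\<lambda>n. \<Sum>i. moment_beta M F X p (Suc n + i) / ennreal (e (Suc n + i) powr p * real (Suc n + i) powr (p - 1))"
    have "ennreal (a (Suc 0)) * ?T 0 \<le> K_weighted_tol M F X p a e"
      unfolding K_weighted_tol_def
      using sum_le_suminf[of "\<lambda>n. ennreal (a (Suc n)) * ?T n" "{0}"] by (simp add: summableI)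
    then have "ennreal (a (Suc 0)) * ?T 0 < \<infinity>" using fin by (rule order_le_less_trans)
    then have "?T 0 < \<infinity>" using a by (auto simp: ennreal_mult_less_top)
    then have "(\<Sum>i. moment_beta M F X p (Suc i) / ennreal (e (Suc i) powr p * real (Suc i) powr (p - 1))) < \<infinity>"
      by simp
    then have "AE \<omega> in M. \<forall>\<^sub>F n in sequentially. norm (X n \<omega> /\<^sub>R real n) \<le> e n"
      using e by (intro eventually_not_exceed[OF tail]) auto
    then show "AE \<omega> in M. limsup (\<lambda>n. ereal (norm (X n \<omega> /\<^sub>R real n) * inverse (e n))) \<le> 1"
    proof eventually_elim
      case (elim \<omega>)
      from elim eventually_ge_at_top[of 1]
      have "\<forall>\<^sub>F n in sequentially. ereal (norm (X n \<omega> /\<^sub>R real n) * inverse (e n)) \<le> 1"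
      proof eventually_elim
        case (elim n)
        then have "0 < e n" using e by simp
        with elim(1) have "norm (X n \<omega> /\<^sub>R real n) * inverse (e n) \<le> e n * inverse (e n)"
          by (intro mult_right_mono) auto
        also have "\<dots> = 1" using \<open>0 < e n\<close> by simp
        finally show ?case by (simp only: ereal_less_eq(3) one_ereal_def)
      qed
      then show ?case by (rule Limsup_bounded)
    qed
    have "(\<integral>\<^sup>+ \<omega>. S_sum a (last_exceed X e \<omega>) \<partial>M) \<le> ennreal K * K_weighted_tol M F X p a e"
      using e by (intro nn_integral_last_exceed_le[OF tail]) auto
    also have "\<dots> \<le> ennreal (C_const p) * K_weighted_tol M F X p a e"
      using K by (intro mult_right_mono ennreal_leI) auto
    finally show "(\<integral>\<^sup>+ \<omega>. S_sum a (last_exceed X e \<omega>) \<partial>M)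
        \<le> ennreal (C_const p) * K_weighted_tol M F X p a e" .
  qed
  ultimately show ?thesis by blast
qed

end
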